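(* Let $r>0$ and let $g$ be a $C^4$ Riemannian metric on the ball $B(O,r)\subseteq\mathbb{R}^2$, with coordinates $(x,y)$, whose Gauss curvature $k$ satisfies $k\geq 0$. Suppose that $X:(B(O,r),g)\to(\mathbb{R}^3,g_{can})$ is a $C^{1,1}$ isometric embedding of the form $$X:(x,y)\longmapsto (x,y,u(x,y)),$$ where $u(0,0)=0$ and $u_x(0,0)=u_y(0,0)=0$. If in addition $u$ is (weakly) convex, then $X\in C^{2,1}(B(O,r'))$ for any $0<r'<r$.
   Context: $B(O,r)$ is the open ball in $\mathbb{R}^2$ of radius $r$ centred at the origin $O=(0,0)$, and $g_{can}$ is the standard flat metric on $\mathbb{R}^3$. The coordinates $x,y$ on the ball are those in which $g$ is $C^4$. Isometric means $X^*g_{can}=g$, i.e. here $g=dx^2+dy^2+du^2=(1+u_x^2)\,dx^2+2u_xu_y\,dx\,dy+(1+u_y^2)\,dy^2$. $C^{k,1}$ denotes functions (or maps) with derivatives up to order $k$ which are Lipschitz. *)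

theory Defs
  imports "HOL-Analysis.Analysis"
begin

definition pderiv_at :: "'n \<Rightarrow> (real^'n \<Rightarrow> 'b) \<Rightarrow> real^'n \<Rightarrow> 'b::real_normed_vector"
  where "pderiv_at i f p = frechet_derivative f (at p) (axis i 1)"

(* Ck_on and Ck1_on are meant for open S: derivatives are full
   derivatives at the points of S. *)

primrec Ck_on :: "nat \<Rightarrow> (real^'n \<Rightarrow> 'b::real_normed_vector) \<Rightarrow> (real^'n) set \<Rightarrow> bool" where
  "Ck_on 0 f S \<longleftrightarrow> continuous_on S f"
| "Ck_on (Suc k) f S \<longleftrightarrow> (\<forall>p\<in>S. f differentiable (at p)) \<and> (\<forall>i. Ck_on k (pderiv_at i f) S)"

(* C^{k,1}: all partial derivatives of order 0, ..., k exist and are Lipschitz on the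
   whole of S (not merely locally Lipschitz). *)
primrec Ck1_on :: "nat \<Rightarrow> (real^'n \<Rightarrow> 'b::real_normed_vector) \<Rightarrow> (real^'n) set \<Rightarrow> bool" where
  "Ck1_on 0 f S \<longleftrightarrow> (\<exists>L. L-lipschitz_on S f)"
| "Ck1_on (Suc k) f S \<longleftrightarrow> (\<exists>L. L-lipschitz_on S f)
     \<and> (\<forall>p\<in>S. f differentiable (at p)) \<and> (\<forall>i. Ck1_on k (pderiv_at i f) S)"

(* A metric in coordinates is the field p \<mapsto> (g_{ij}(p)) of its coefficient matrices. *)
definition Riemannian_metric_on :: "nat \<Rightarrow> (real^'n) set \<Rightarrow> (real^'n \<Rightarrow> real^'n^'n) \<Rightarrow> bool"
  where "Riemannian_metric_on k S g \<longleftrightarrow> Ck_on k g S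
     \<and> (\<forall>p\<in>S. transpose (g p) = g p \<and> (\<forall>v. v \<noteq> 0 \<longrightarrow> v \<bullet> (g p *v v) > 0))"

(* Gamma^k_{ij} *)
definition christoffel :: "(real^'n \<Rightarrow> real^'n^'n) \<Rightarrow> 'n \<Rightarrow> 'n \<Rightarrow> 'n \<Rightarrow> real^'n \<Rightarrow> real"
  where "christoffel g k i j p = (1/2) * (\<Sum>l\<in>UNIV. matrix_inv (g p) $ k $ l *
     (pderiv_at i (\<lambda>q. g q $ j $ l) p + pderiv_at j (\<lambda>q. g q $ i $ l) p
      - pderiv_at l (\<lambda>q. g q $ i $ j) p))"

(* The l-th component of R(d_i,d_j)d_k, where
   R(X,Y)Z = nabla_X nabla_Y Z - nabla_Y nabla_X Z - nabla_{[X,Y]} Z. *)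
definition riemann_curvature ::
    "(real^'n \<Rightarrow> real^'n^'n) \<Rightarrow> 'n \<Rightarrow> 'n \<Rightarrow> 'n \<Rightarrow> 'n \<Rightarrow> real^'n \<Rightarrow> real"
  where "riemann_curvature g l i j k p =
     pderiv_at i (christoffel g l j k) p - pderiv_at j (christoffel g l i k) p
     + (\<Sum>m\<in>UNIV. christoffel g m j k p * christoffel g l i m p
                - christoffel g m i k p * christoffel g l j m p)"

(* g(R(d_1,d_2)d_2, d_1) / det g, positive on round spheres. *)
definition gauss_curvature :: "(real^2 \<Rightarrow> real^2^2) \<Rightarrow> real^2 \<Rightarrow> real"
  where "gauss_curvature g p =
     (\<Sum>l\<in>UNIV. riemann_curvature g l 1 2 2 p * g p $ l $ 1) / det (g p)"

(* X^* g_can = g on S, with g_can the Euclidean inner product. *)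
definition isometric_on :: "(real^'n) set \<Rightarrow> (real^'n \<Rightarrow> real^'n^'n) \<Rightarrow> (real^'n \<Rightarrow> real^'m) \<Rightarrow> bool"
  where "isometric_on S g X \<longleftrightarrow> (\<forall>p\<in>S. \<forall>v w.
     frechet_derivative X (at p) v \<bullet> frechet_derivative X (at p) w = v \<bullet> (g p *v w))"

definition Ck1_embedding_on :: "nat \<Rightarrow> (real^'n) set \<Rightarrow> (real^'n \<Rightarrow> real^'m) \<Rightarrow> bool"
  where "Ck1_embedding_on k S X \<longleftrightarrow> Ck1_on k X S
     \<and> (\<forall>p\<in>S. inj (frechet_derivative X (at p)))
     \<and> (\<exists>Y. homeomorphism S (X ` S) X Y)"

end

theory Submission
  imports Defs
begin

text \<open>
The isometry condition says that the metric minus the identity is the rank-one matrix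
\<open>u\<^sub>i u\<^sub>j\<close>.  Along a line \<open>x + t v\<close> with \<open>v\<close> a unit vector, the slope \<open>a t = Du (x + t v) v\<close>
therefore has the square \<open>v \<bullet> g v - 1\<close>, which is a \<open>C\<^sup>4\<close> function of \<open>t\<close> with bounds that do not
depend on \<open>x\<close> in a smaller ball or on \<open>v\<close>; and convexity of \<open>u\<close> makes \<open>a\<close> monotone.  The
regularity of \<open>u\<close> follows from these two facts, first on lines and then in the plane.

On a line, \<open>monotone_root_expansion\<close> says that a monotone function whose square has four
bounded derivatives is affine at each point up to a quadratic error with a uniform constant.
Monotonicity is essential: the square of \<open>sqrt (t\<^sup>2 + \<epsilon>\<^sup>2)\<close> is a polynomial, but its second
derivative at \<open>0\<close> is \<open>1 / \<epsilon>\<close>.  Write \<open>f = a\<^sup>2\<close>.  Where \<open>a = \<mu>\<^sup>2 > 0\<close>, the second derivative of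
\<open>a\<close> is \<open>(2 f f'' - f'\<^sup>2) / (4 a\<^sup>3)\<close>, so the numerator must be \<open>O(\<mu>\<^sup>6)\<close>.  The decisive
scale is \<open>c \<mu>\<close> for a small constant \<open>c\<close>.  If \<open>a\<close> has no sign change within distance
\<open>c \<mu>\<close> to the left, then \<open>0 \<le> f \<le> \<mu>\<^sup>4\<close> there, and interpolation gives \<open>f' = O(\<mu>\<^sup>3)\<close> and
\<open>f'' = O(\<mu>\<^sup>2)\<close> (\<open>discriminant_bound_no_zero\<close>).  If \<open>a\<close> vanishes at a closer point \<open>z\<close>, then
\<open>f (z + s) = \<alpha> s\<^sup>2 + \<beta> s\<^sup>3 + O(s\<^sup>4)\<close>; the leading terms of the numerator cancel, and \<open>f \<ge> 0\<close>
on both sides of \<open>z\<close> bounds \<open>\<beta>\<close> (\<open>discriminant_bound_near_zero\<close>).  At a zero of \<open>a\<close> the same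
expansion of \<open>f\<close> yields the expansion of \<open>a\<close> with slope \<open>sqrt \<alpha>\<close> on both sides
(\<open>expansion_at_zero\<close>), and \<open>expansion_at_positive\<close> continues an expansion across a zero.

Integrating, \<open>u\<close> has on each line a second-order Taylor expansion with uniform cubic error, so
its third differences in every single direction are \<open>O(|h|\<^sup>3)\<close>.  An algebraic identity expresses
mixed third differences by differences in single directions
(\<open>mixed_third_difference\<close>).  Hence the second directional derivatives are Lipschitz in the base
point.  Comparing the expansions at \<open>x\<close> and at \<open>x + k\<close> then shows that the gradient
is differentiable and that its derivative is the polarization of the second directional
derivative (\<open>Du_increment\<close>, \<open>has_derivative_Du\<close>, \<open>hess_lipschitz\<close>).  In this way the points where
the gradient vanishes, at which the metric does not determine the second derivatives of \<open>u\<close>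
by differentiation, need no separate treatment in the plane.
\<close>

section \<open>Monotone functions with a smooth square\<close>

text \<open>
\<open>F k\<close> is the \<open>k\<close>-th derivative of \<open>a\<^sup>2\<close> on the interval of radius \<open>R\<close> around \<open>x\<close>.  The
normalization \<open>R \<le> 1 \<le> M\<close> lets powers of \<open>R\<close> and \<open>M\<close> be compared freely.
\<close>

locale smooth_square =
  fixes F :: "nat \<Rightarrow> real \<Rightarrow> real" and a :: "real \<Rightarrow> real" and M R x :: real
  assumes M: "1 \<le> M" and R: "0 < R" "R \<le> 1"
    and deriv: "\<And>k t. k < 4 \<Longrightarrow> \<bar>t - x\<bar> \<le> R \<Longrightarrow> (F k has_real_derivative F (Suc k) t) (at t)"
    and bound: "\<And>k t. k \<le> 4 \<Longrightarrow> \<bar>t - x\<bar> \<le> R \<Longrightarrow> \<bar>F k t\<bar> \<le> M"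
    and square: "\<And>t. \<bar>t - x\<bar> \<le> R \<Longrightarrow> F 0 t = (a t)\<^sup>2"
    and mono: "\<And>s t. \<bar>s - x\<bar> \<le> R \<Longrightarrow> \<bar>t - x\<bar> \<le> R \<Longrightarrow> s \<le> t \<Longrightarrow> a s \<le> a t"
    and cont: "continuous_on {x - R..x + R} a"
begin

lemma restrict:
  assumes "0 < R'" "\<bar>x' - x\<bar> + R' \<le> R"
  shows "smooth_square F a M R' x'"
proof -
  have *: "\<bar>t - x\<bar> \<le> R" if "\<bar>t - x'\<bar> \<le> R'" for t
    using that assms by linarith
  have **: "{x' - R'..x' + R'} \<subseteq> {x - R..x + R}"
    using assms by auto
  show ?thesis
    using assms R M * by unfold_locales
      (auto intro: deriv bound square mono continuous_on_subset[OF cont **])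
qed

text \<open>
Reflection exchanges the positive and the negative values of \<open>a\<close> and preserves monotonicity.
\<close>

lemma reflect:
  "smooth_square (\<lambda>k t. (-1) ^ k * F k (- t)) (\<lambda>t. - a (- t)) M R (- x)"
proof unfold_locales
  have *: "\<bar>- t - x\<bar> \<le> R" if "\<bar>t - - x\<bar> \<le> R" for t
    using that by linarith
  show "1 \<le> M" "0 < R" "R \<le> 1" using M R by auto
  fix k :: nat and t
  assume t: "\<bar>t - - x\<bar> \<le> R"
  show "\<bar>(- 1) ^ k * F k (- t)\<bar> \<le> M" if "k \<le> 4"
    using bound[OF that *[OF t]] by (simp add: abs_mult)
  show "(- 1) ^ 0 * F 0 (- t) = (- a (- t))\<^sup>2"
    using square[OF *[OF t]] by simp
  show "((\<lambda>t. (- 1) ^ k * F k (- t)) has_real_derivative (- 1) ^ Suc k * F (Suc k) (- t)) (at t)"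
    if "k < 4"
    using DERIV_cmult[OF DERIV_chain2[OF deriv[OF that *[OF t]] DERIV_minus[OF DERIV_ident]], of "(- 1) ^ k"]
    by simp
next
  fix s t
  assume "\<bar>s - - x\<bar> \<le> R" "\<bar>t - - x\<bar> \<le> R" "s \<le> t"
  then show "- a (- s) \<le> - a (- t)"
    using mono[of "- t" "- s"] by (auto simp: abs_le_iff)
next
  show "continuous_on {- x - R..- x + R} (\<lambda>t. - a (- t))"
    by (intro continuous_intros continuous_on_compose2[OF cont]) auto
qed

lemma taylor:
  assumes "\<bar>c - x\<bar> \<le> R" "\<bar>c + s - x\<bar> \<le> R"
  shows taylor0: "\<bar>F 0 (c + s) - (F 0 c + F 1 c * s + F 2 c / 2 * s\<^sup>2 + F 3 c / 6 * s ^ 3)\<bar> \<le> M / 24 * s ^ 4"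
    and taylor1: "\<bar>F 1 (c + s) - (F 1 c + F 2 c * s + F 3 c / 2 * s\<^sup>2)\<bar> \<le> M / 6 * \<bar>s\<bar> ^ 3"
    and taylor2: "\<bar>F 2 (c + s) - (F 2 c + F 3 c * s)\<bar> \<le> M / 2 * s\<^sup>2"
proof -
  have T: "\<exists>t. \<bar>t - x\<bar> \<le> R \<and> F j (c + s) =
      (\<Sum>m<n. F (j + m) c / fact m * s ^ m) + F (j + n) t / fact n * s ^ n"
    if n: "0 < n" "j + n = 4" for j n
  proof (cases "s = 0")
    case True
    moreover obtain n' where "n = Suc n'" using n(1) by (cases n) auto
    ultimately show ?thesis
      using assms by (intro exI[of _ c]) (simp add: sum.lessThan_Suc_shift)
  next
    case False
    have "\<exists>t. (if c + s < c then c + s < t \<and> t < c else c < t \<and> t < c + s) \<and>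
       F j (c + s) = (\<Sum>m<n. (F (j + m) c / fact m) * (c + s - c) ^ m)
          + (F (j + n) t / fact n) * (c + s - c) ^ n"
      by (rule Taylor[where a = "x - R" and b = "x + R"])
         (use n False assms in \<open>auto intro!: deriv simp: abs_le_iff\<close>)
    then obtain t where t: "if c + s < c then c + s < t \<and> t < c else c < t \<and> t < c + s"
      and eq: "F j (c + s) = (\<Sum>m<n. (F (j + m) c / fact m) * s ^ m)
          + (F (j + n) t / fact n) * s ^ n"
      by auto
    have "\<bar>t - x\<bar> \<le> R"
      using t assms by (auto split: if_splits)
    with eq show ?thesis by blast
  qed
  obtain t where t: "\<bar>t - x\<bar> \<le> R" "F 0 (c + s) =
      (\<Sum>m<4. F m c / fact m * s ^ m) + F 4 t / fact 4 * s ^ 4"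
    using T[of 4 0] by auto
  have "\<bar>F 4 t * s ^ 4\<bar> \<le> M * s ^ 4"
    using bound[OF _ t(1), of 4] by (auto simp: abs_mult intro!: mult_mono)
  with t(2) show "\<bar>F 0 (c + s) - (F 0 c + F 1 c * s + F 2 c / 2 * s\<^sup>2 + F 3 c / 6 * s ^ 3)\<bar> \<le> M / 24 * s ^ 4"
    by (simp add: eval_nat_numeral fact_numeral)
  obtain t where t: "\<bar>t - x\<bar> \<le> R" "F 1 (c + s) =
      (\<Sum>m<3. F (1 + m) c / fact m * s ^ m) + F 4 t / fact 3 * s ^ 3"
    using T[of 3 1] by auto
  have "\<bar>F 4 t * s ^ 3\<bar> \<le> M * \<bar>s\<bar> ^ 3"
    using bound[OF _ t(1), of 4] by (auto simp: abs_mult power_abs intro!: mult_mono)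
  with t(2) show "\<bar>F 1 (c + s) - (F 1 c + F 2 c * s + F 3 c / 2 * s\<^sup>2)\<bar> \<le> M / 6 * \<bar>s\<bar> ^ 3"
    by (simp add: eval_nat_numeral fact_numeral)
  obtain t where t: "\<bar>t - x\<bar> \<le> R" "F 2 (c + s) =
      (\<Sum>m<2. F (2 + m) c / fact m * s ^ m) + F 4 t / fact 2 * s ^ 2"
    using T[of 2 2] by auto
  have "\<bar>F 4 t * s ^ 2\<bar> \<le> M * s ^ 2"
    using bound[OF _ t(1), of 4] by (auto simp: abs_mult intro!: mult_mono)
  with t(2) show "\<bar>F 2 (c + s) - (F 2 c + F 3 c * s)\<bar> \<le> M / 2 * s\<^sup>2"
    by (simp add: eval_nat_numeral fact_numeral)
qed

text \<open>
A zero of \<open>a\<close> is a minimum of \<open>a\<^sup>2\<close>; the second derivative is read off from the sum of the Taylor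
expansions at \<open>z + s\<close> and \<open>z - s\<close>, where the odd terms cancel.
\<close>

lemma vanishing:
  assumes "\<bar>z - x\<bar> < R" "a z = 0"
  shows "F 0 z = 0" "F 1 z = 0" "0 \<le> F 2 z"
proof -
  show 0: "F 0 z = 0" using square[of z] assms by simp
  have d: "(F 0 has_real_derivative F 1 z) (at z)"
    using deriv[of 0 z] assms by simp
  show 1: "F 1 z = 0"
  proof (rule DERIV_local_min[OF d])
    show "0 < R - \<bar>z - x\<bar>" using assms by simp
    show "\<forall>y. \<bar>z - y\<bar> < R - \<bar>z - x\<bar> \<longrightarrow> F 0 z \<le> F 0 y"
      using 0 by (auto simp: square)
  qed
  show "0 \<le> F 2 z"
  proof (rule field_le_epsilon)
    fix e :: real assume e: "0 < e"
    define s where "s = min (R - \<bar>z - x\<bar>) (e / M)"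
    have s: "0 < s" "s \<le> R - \<bar>z - x\<bar>" "s \<le> e / M" "s \<le> 1"
      using assms e M R by (auto simp: s_def)
    have a: "\<bar>z - x\<bar> \<le> R" "\<bar>z + s - x\<bar> \<le> R" "\<bar>z + - s - x\<bar> \<le> R"
      using s assms by auto
    have "0 \<le> F 0 (z + s)" "0 \<le> F 0 (z + - s)"
      using a by (auto simp: square)
    then have "0 \<le> F 2 z * s\<^sup>2 + M / 12 * s ^ 4"
      using taylor0[OF a(1,2)] taylor0[OF a(1,3)] unfolding 0 1 abs_le_iff by simp
    also have "\<dots> = s\<^sup>2 * (F 2 z + M / 12 * s\<^sup>2)"
      by (simp add: algebra_simps eval_nat_numeral)
    finally have "0 \<le> F 2 z + M / 12 * s\<^sup>2"
      using s by (simp add: zero_le_mult_iff)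
    moreover have "M * s\<^sup>2 \<le> M * s"
      using s M by (intro mult_left_mono) (auto simp: power2_eq_square mult_le_one)
    moreover have "M * s \<le> e" "0 < M * s" using s M by (auto simp: field_simps)
    ultimately show "0 \<le> F 2 z + e" by linarith
  qed
qed

end

text \<open>
The numerator \<open>2 f f'' - f'\<^sup>2\<close> at distance \<open>s\<close> from a double zero of \<open>f\<close>.  The exact terms
\<open>4 \<alpha>\<^sup>2 s\<^sup>2\<close> cancel, and the remainder has total degree six in \<open>s\<close> and \<open>\<theta>\<close> with at least three
factors \<open>s\<close>.  In the application \<open>s \<theta>\<close> is the value of \<open>sqrt f\<close>.
\<close>

lemma discriminant_at_distance:
  fixes \<alpha> \<beta> \<theta> s K e0 e1 e2 :: real
  assumes "0 < s" "s \<le> \<theta>" "\<bar>\<alpha>\<bar> \<le> K * \<theta>\<^sup>2" "\<bar>\<beta>\<bar> \<le> K * \<theta>"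
    and "\<bar>e0\<bar> \<le> K * s ^ 4" "\<bar>e1\<bar> \<le> K * s ^ 3" "\<bar>e2\<bar> \<le> K * s\<^sup>2"
  shows "\<bar>2 * (\<alpha> * s\<^sup>2 + \<beta> * s ^ 3 + e0) * (2 * \<alpha> + 6 * \<beta> * s + e2)
            - (2 * \<alpha> * s + 3 * \<beta> * s\<^sup>2 + e1)\<^sup>2\<bar> \<le> 40 * K\<^sup>2 * (s * \<theta>) ^ 3"
proof -
  have \<theta>: "0 < \<theta>" using assms by linarith
  \<comment> \<open>dimensionless quantities, after which the claim is about a polynomial in \<open>\<sigma> \<in> [0, 1]\<close>\<close>
  define A B E0 E1 E2 \<sigma> where "A = \<alpha> / \<theta>\<^sup>2" "B = \<beta> / \<theta>" "E0 = e0 / s ^ 4" "E1 = e1 / s ^ 3"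
    "E2 = e2 / s\<^sup>2" "\<sigma> = s / \<theta>"
  note defs = this
  have eqs: "\<alpha> = A * \<theta>\<^sup>2" "\<beta> = B * \<theta>" "e0 = E0 * (\<sigma> * \<theta>) ^ 4" "e1 = E1 * (\<sigma> * \<theta>) ^ 3"
    "e2 = E2 * (\<sigma> * \<theta>)\<^sup>2" "s = \<sigma> * \<theta>"
    using \<theta> assms(1) by (auto simp: defs)
  have b: "\<bar>A\<bar> \<le> K" "\<bar>B\<bar> \<le> K" "\<bar>E0\<bar> \<le> K" "\<bar>E1\<bar> \<le> K" "\<bar>E2\<bar> \<le> K"
    using assms \<theta> by (auto simp: defs field_simps abs_divide)
  have \<sigma>: "0 \<le> \<sigma>" "\<sigma> \<le> 1" using assms \<theta> by (auto simp: defs)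
  have p: "\<bar>u * v\<bar> \<le> K\<^sup>2" if "\<bar>u\<bar> \<le> K" "\<bar>v\<bar> \<le> K" for u v
    using mult_mono[OF that] order_trans[OF abs_ge_zero that(1)]
    by (simp add: abs_mult power2_eq_square)
  have q: "\<bar>c * \<sigma>\<bar> \<le> d" if "\<bar>c\<bar> \<le> d" for c d
    using mult_mono[of "\<bar>c\<bar>" d \<sigma> 1] that \<sigma> by (auto simp: abs_mult)
  define c3 c4 c5 c6 where "c3 = 4 * (A * B)"
    "c4 = 2 * (A * E2) + 3 * (B * B) + 4 * (E0 * A) - 4 * (A * E1)"
    "c5 = 2 * (B * E2) + 12 * (E0 * B) - 6 * (B * E1)"
    "c6 = 2 * (E0 * E2) - E1 * E1"
  note cdefs = this
  have c: "\<bar>c3\<bar> \<le> 4 * K\<^sup>2" "\<bar>c4\<bar> \<le> 13 * K\<^sup>2" "\<bar>c5\<bar> \<le> 20 * K\<^sup>2" "\<bar>c6\<bar> \<le> 3 * K\<^sup>2"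
    using p[OF b(1,2)] p[OF b(1,5)] p[OF b(2,2)] p[OF b(3,1)] p[OF b(1,4)] p[OF b(2,5)]
      p[OF b(3,2)] p[OF b(2,4)] p[OF b(3,5)] p[OF b(4,4)]
    unfolding cdefs abs_le_iff by linarith+
  have "2 * (\<alpha> * s\<^sup>2 + \<beta> * s ^ 3 + e0) * (2 * \<alpha> + 6 * \<beta> * s + e2)
            - (2 * \<alpha> * s + 3 * \<beta> * s\<^sup>2 + e1)\<^sup>2
      = (s * \<theta>) ^ 3 * (c3 + c4 * \<sigma> + c5 * \<sigma> * \<sigma> + c6 * \<sigma> * \<sigma> * \<sigma>)"
    unfolding eqs cdefs by algebra
  also have "\<bar>\<dots>\<bar> = (s * \<theta>) ^ 3 * \<bar>c3 + c4 * \<sigma> + c5 * \<sigma> * \<sigma> + c6 * \<sigma> * \<sigma> * \<sigma>\<bar>"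
    using assms(1) \<theta> by (simp add: abs_mult)
  also have "\<dots> \<le> (s * \<theta>) ^ 3 * (40 * K\<^sup>2)"
  proof (rule mult_left_mono)
    show "\<bar>c3 + c4 * \<sigma> + c5 * \<sigma> * \<sigma> + c6 * \<sigma> * \<sigma> * \<sigma>\<bar> \<le> 40 * K\<^sup>2"
      using c(1) q[OF c(2)] q[OF q[OF c(3)]] q[OF q[OF q[OF c(4)]]] unfolding abs_le_iff by linarith
  qed (use assms(1) \<theta> in auto)
  finally show ?thesis by (simp add: mult_ac)
qed

context smooth_square
begin

text \<open>
On \<open>[x - c \<mu>, x]\<close> the function \<open>F 0\<close> takes values in \<open>[0, \<mu>\<^sup>4]\<close> and agrees with a cubic up to
\<open>O(\<mu>\<^sup>4)\<close>.  A cubic is determined by its values at four equidistant points, so its coefficients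
at \<open>x\<close> are controlled by \<open>\<mu>\<^sup>4\<close> divided by the powers of \<open>\<mu>\<close>.
\<close>

lemma discriminant_bound_no_zero:
  fixes c \<mu> K :: real
  assumes c: "0 < c" "c \<le> 1" and \<mu>: "0 < \<mu>" "c * \<mu> \<le> R" "a x = \<mu>\<^sup>2"
    and nonneg: "0 \<le> a (x - c * \<mu>)" and K: "K = 54 / c\<^sup>2 + M"
  shows "\<bar>2 * F 0 x * F 2 x - (F 1 x)\<^sup>2\<bar> \<le> 3 * K\<^sup>2 * (a x) ^ 3"
proof -
  define h where "h = c * \<mu> / 3"
  have h: "0 < h" "3 * h \<le> R" using c \<mu> by (auto simp: h_def)
  have F0: "F 0 x = \<mu> ^ 4"
    using square[of x] \<mu> R by (simp add: eval_nat_numeral)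
  have val: "0 \<le> F 0 (x + - s) \<and> F 0 (x + - s) \<le> \<mu> ^ 4" if "0 \<le> s" "s \<le> 3 * h" for s
  proof -
    have "0 \<le> a (x + - s)"
      using nonneg mono[of "x - c * \<mu>" "x + - s"] that h by (auto simp: h_def)
    moreover have "a (x + - s) \<le> a x"
      using that h by (intro mono) auto
    moreover have "F 0 (x + - s) = (a (x + - s))\<^sup>2"
      using that h by (intro square) auto
    ultimately show ?thesis
      using F0 square[of x] R power_mono[of "a (x + - s)" "a x" 2] by auto
  qed
  have x0: "\<bar>x - x\<bar> \<le> R" using R by simp
  have t: "\<bar>F 0 (x + - h) - (F 0 x - F 1 x * h + F 2 x / 2 * h\<^sup>2 - F 3 x / 6 * h ^ 3)\<bar> \<le> M / 24 * h ^ 4"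
    "\<bar>F 0 (x + - (2 * h)) - (F 0 x - 2 * (F 1 x * h) + 2 * (F 2 x * h\<^sup>2) - 4 * (F 3 x / 3 * h ^ 3))\<bar>
        \<le> M * 2 / 3 * h ^ 4"
    "\<bar>F 0 (x + - (3 * h)) - (F 0 x - 3 * (F 1 x * h) + 9 / 2 * (F 2 x * h\<^sup>2) - 9 / 2 * (F 3 x * h ^ 3))\<bar>
        \<le> M * 27 / 8 * h ^ 4"
    using taylor0[OF x0, of "- h"] taylor0[OF x0, of "- (2 * h)"] taylor0[OF x0, of "- (3 * h)"] h
    by (simp_all add: power_mult_distrib mult_ac)
  have v: "0 \<le> F 0 (x + - h)" "F 0 (x + - h) \<le> \<mu> ^ 4" "0 \<le> F 0 (x + - (2 * h))"
    "F 0 (x + - (2 * h)) \<le> \<mu> ^ 4" "0 \<le> F 0 (x + - (3 * h))" "F 0 (x + - (3 * h)) \<le> \<mu> ^ 4"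
    using val[of h] val[of "2 * h"] val[of "3 * h"] h by auto
  \<comment> \<open>the combination \<open>2 f(0) - 5 f(-h) + 4 f(-2h) - f(-3h)\<close> isolates the second derivative of a cubic\<close>
  have "\<bar>F 2 x * h\<^sup>2\<bar> \<le> 6 * \<mu> ^ 4 + 25 / 4 * (M * h ^ 4)"
    using t v unfolding F0 abs_le_iff by (simp add: field_simps)
  also have "\<dots> = (54 / c\<^sup>2 * \<mu>\<^sup>2 + 25 / 36 * (M * c\<^sup>2 * \<mu>\<^sup>2)) * h\<^sup>2"
    using c by (simp add: h_def field_simps eval_nat_numeral)
  also have "\<dots> \<le> K * \<mu>\<^sup>2 * h\<^sup>2"
  proof (rule mult_right_mono)
    have "M * c\<^sup>2 * \<mu>\<^sup>2 \<le> M * 1 * \<mu>\<^sup>2"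
      using M c by (intro mult_right_mono mult_left_mono power_le_one) auto
    moreover have "0 \<le> M * \<mu>\<^sup>2" using M by simp
    ultimately have "25 / 36 * (M * c\<^sup>2 * \<mu>\<^sup>2) \<le> M * \<mu>\<^sup>2" by linarith
    then show "54 / c\<^sup>2 * \<mu>\<^sup>2 + 25 / 36 * (M * c\<^sup>2 * \<mu>\<^sup>2) \<le> K * \<mu>\<^sup>2"
      by (simp add: K algebra_simps)
  qed auto
  finally have F2: "\<bar>F 2 x\<bar> \<le> K * \<mu>\<^sup>2"
    using h by (simp add: abs_mult)
  \<comment> \<open>likewise \<open>11 f(0) - 18 f(-h) + 9 f(-2h) - 2 f(-3h)\<close> isolates six times the first derivative\<close>
  have "\<bar>F 1 x * h\<bar> \<le> 4 * \<mu> ^ 4 + 3 * (M * h ^ 4)"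
    using t v unfolding F0 abs_le_iff by (simp add: field_simps)
  also have "\<dots> = (12 / c * \<mu> ^ 3 + 1 / 9 * (M * c ^ 3 * \<mu> ^ 3)) * h"
    using c by (simp add: h_def field_simps eval_nat_numeral)
  also have "\<dots> \<le> K * \<mu> ^ 3 * h"
  proof (rule mult_right_mono)
    have "M * c ^ 3 * \<mu> ^ 3 \<le> M * 1 * \<mu> ^ 3"
      using M c \<mu> by (intro mult_right_mono mult_left_mono power_le_one) auto
    moreover have "0 \<le> M * \<mu> ^ 3" using M \<mu> by simp
    ultimately have 1: "1 / 9 * (M * c ^ 3 * \<mu> ^ 3) \<le> M * \<mu> ^ 3" by linarith
    have "c\<^sup>2 \<le> c * 1" using c by (auto simp: power2_eq_square intro!: mult_left_mono)
    then have "12 / c \<le> 54 / c\<^sup>2"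
      using c by (intro frac_le) auto
    then have "12 / c * \<mu> ^ 3 \<le> 54 / c\<^sup>2 * \<mu> ^ 3"
      using \<mu> by (intro mult_right_mono) auto
    with 1 show "12 / c * \<mu> ^ 3 + 1 / 9 * (M * c ^ 3 * \<mu> ^ 3) \<le> K * \<mu> ^ 3"
      by (simp add: K algebra_simps)
  qed (use h in auto)
  finally have F1: "\<bar>F 1 x\<bar> \<le> K * \<mu> ^ 3"
    using h by (simp add: abs_mult)
  have K1: "1 \<le> K" using M c by (simp add: K add_increasing)
  have "\<bar>2 * F 0 x * F 2 x\<bar> \<le> 2 * (\<mu> ^ 4 * (K * \<mu>\<^sup>2))"
    using F2 \<mu> by (simp add: F0 abs_mult)
  also have "\<dots> \<le> 2 * (K\<^sup>2 * \<mu> ^ 6)"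
    using K1 \<mu> by (simp add: eval_nat_numeral mult_ac)
  finally have 1: "\<bar>2 * F 0 x * F 2 x\<bar> \<le> 2 * (K\<^sup>2 * \<mu> ^ 6)" .
  have "\<bar>F 1 x\<bar>\<^sup>2 \<le> (K * \<mu> ^ 3)\<^sup>2"
    using F1 by (intro power_mono) auto
  also have "\<dots> = K\<^sup>2 * \<mu> ^ 6" by (simp add: power_mult_distrib flip: power_mult)
  finally have "\<bar>2 * F 0 x * F 2 x - (F 1 x)\<^sup>2\<bar> \<le> 3 * (K\<^sup>2 * \<mu> ^ 6)"
    using 1 zero_le_power2[of "F 1 x"] unfolding power2_abs by linarith
  then show ?thesis
    using \<mu> by (simp add: mult_ac flip: power_mult)
qed

text \<open>
With \<open>z = x - s\<close> the zero and \<open>\<theta> = \<mu>\<^sup>2 / s\<close>, the condition \<open>s \<le> c \<mu>\<close> becomes \<open>s \<le> c\<^sup>2 \<theta>\<close>: the zero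
is close in comparison with the mean slope \<open>\<theta>\<close> between \<open>z\<close> and \<open>x\<close>.  The expansion of \<open>F 0\<close> at
\<open>z\<close> gives \<open>\<alpha> + \<beta> s \<le> 2 \<theta>\<^sup>2\<close>, and non-negativity of \<open>F 0\<close> at distance of order \<open>\<theta>\<close> from \<open>z\<close>
turns this into \<open>|\<beta>| = O(\<theta>)\<close> and \<open>\<alpha> = O(\<theta>\<^sup>2)\<close>.
\<close>

lemma discriminant_bound_near_zero:
  fixes s \<mu> c K :: real
  assumes c: "0 < c" "c \<le> R / (4 * M)" and \<mu>: "0 < \<mu>" "a x = \<mu>\<^sup>2"
    and s: "0 < s" "s \<le> c * \<mu>" "a (x - s) = 0"
    and K: "K = 2 + 8 * M * (2 + M) / R"
  shows "\<bar>2 * F 0 x * F 2 x - (F 1 x)\<^sup>2\<bar> \<le> 40 * K\<^sup>2 * (a x) ^ 3"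
proof -
  define \<theta> \<alpha> \<beta> l where "\<theta> = \<mu>\<^sup>2 / s" "\<alpha> = F 2 (x - s) / 2" "\<beta> = F 3 (x - s) / 6" "l = R / (8 * M)"
  note defs = this
  have F0: "F 0 x = \<mu> ^ 4"
    using square[of x] \<mu> R by (simp add: eval_nat_numeral)
  have MR: "R / M \<le> R" "R / M \<le> 1"
    using M R frac_le[of R R 1 M] frac_le[of R 1 1 M] by auto
  have c1: "c \<le> R / 4" "c \<le> 1 / 4" "c * M \<le> 1 / 4" "c \<le> 1"
  proof -
    define q where "q = R / M"
    have "c \<le> q / 4" "c * M \<le> R / 4"
      using c M mult_right_mono[of c "R / (4 * M)" M] by (simp_all add: q_def)
    then show "c \<le> R / 4" "c \<le> 1 / 4" "c * M \<le> 1 / 4" "c \<le> 1"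
      using MR R unfolding q_def[symmetric] by linarith+
  qed
  have "\<mu> ^ 4 \<le> M ^ 4"
    using bound[of 0 x] F0 R M power_increasing[of 1 4 M] by auto
  then have "\<mu> \<le> M" using \<mu> M by (simp add: power_mono_iff)
  have "c * \<mu> \<le> R / (4 * M) * M"
    using c \<mu> M R \<open>\<mu> \<le> M\<close> by (intro mult_mono) auto
  then have sR: "s \<le> R / 4" "s \<le> 1 / 4" using s M R by auto
  have \<theta>: "0 < \<theta>" using \<mu> s by (simp add: defs)
  have \<mu>\<theta>: "\<mu>\<^sup>2 = s * \<theta>" using s by (simp add: defs)
  have "s\<^sup>2 \<le> (c * \<mu>)\<^sup>2" using s by (intro power_mono) auto
  also have "\<dots> = s * (c\<^sup>2 * \<theta>)" unfolding power_mult_distrib \<mu>\<theta> by simp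
  finally have "s * s \<le> s * (c\<^sup>2 * \<theta>)" unfolding power2_eq_square[of s] .
  then have s\<theta>: "s \<le> c\<^sup>2 * \<theta>" using s by simp
  have cc: "c\<^sup>2 \<le> 1 / 4" using c1 c mult_mono[of c "1/4" c 1] by (simp add: power2_eq_square)
  then have s\<theta>': "s \<le> \<theta> / 4" using s\<theta> \<theta> mult_right_mono[of "c\<^sup>2" "1/4" \<theta>] by linarith
  have z: "\<bar>x - s - x\<bar> < R" "\<bar>x - s - x\<bar> \<le> R" using sR s R by auto
  note van = vanishing[OF z(1) s(3)]
  \<comment> \<open>division by \<open>\<sigma>\<^sup>2\<close> turns the double zero into a non-negative quadratic in \<open>\<sigma>\<close>\<close>
  have T0: "\<bar>F 0 (x - s + \<sigma>) - \<sigma>\<^sup>2 * (\<alpha> + \<beta> * \<sigma>)\<bar> \<le> \<sigma>\<^sup>2 * (M / 24 * \<sigma>\<^sup>2)"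
    if "\<bar>x - s + \<sigma> - x\<bar> \<le> R" for \<sigma>
    using taylor0[OF z(2) that] unfolding van
    by (simp add: defs algebra_simps eval_nat_numeral)
  have pos: "0 \<le> \<alpha> + \<beta> * \<sigma> + M / 24 * \<sigma>\<^sup>2" if "\<bar>x - s + \<sigma> - x\<bar> \<le> R" "\<sigma> \<noteq> 0" for \<sigma>
  proof -
    have "0 \<le> F 0 (x - s + \<sigma>)" using square[OF that(1)] by simp
    then have "0 \<le> \<sigma>\<^sup>2 * (\<alpha> + \<beta> * \<sigma>) + \<sigma>\<^sup>2 * (M / 24 * \<sigma>\<^sup>2)"
      using T0[OF that(1)] by linarith
    then have "0 \<le> \<sigma>\<^sup>2 * (\<alpha> + \<beta> * \<sigma> + M / 24 * \<sigma>\<^sup>2)"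
      by (simp add: algebra_simps)
    then show ?thesis using that(2) by (simp add: zero_le_mult_iff)
  qed
  have "\<bar>s\<^sup>2 * (\<theta>\<^sup>2 - (\<alpha> + \<beta> * s))\<bar> \<le> s\<^sup>2 * (M / 24 * s\<^sup>2)"
  proof -
    have "F 0 x = s\<^sup>2 * \<theta>\<^sup>2"
      unfolding F0 power_mult_distrib[symmetric] \<mu>\<theta>[symmetric] by simp
    then show ?thesis using T0[of s] R by (simp add: right_diff_distrib)
  qed
  then have eta: "\<bar>\<theta>\<^sup>2 - (\<alpha> + \<beta> * s)\<bar> \<le> M / 24 * s\<^sup>2"
    using s by (simp add: abs_mult)
  have "M * s\<^sup>2 \<le> \<theta>\<^sup>2"
  proof -
    have "M * s\<^sup>2 \<le> M * (c\<^sup>2 * \<theta>)\<^sup>2"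
      using M s s\<theta> by (intro mult_left_mono power_mono) auto
    also have "\<dots> = (c * M) * (c * c\<^sup>2) * \<theta>\<^sup>2" by (simp add: eval_nat_numeral)
    also have "\<dots> \<le> 1 * \<theta>\<^sup>2"
    proof (rule mult_right_mono)
      have "c * c\<^sup>2 \<le> 1" using c c1 cc mult_le_one[of c "c\<^sup>2"] by auto
      then show "c * M * (c * c\<^sup>2) \<le> 1" using c c1 M mult_le_one[of "c * M" "c * c\<^sup>2"] by auto
    qed simp
    finally show ?thesis by simp
  qed
  then have eta2: "\<alpha> + \<beta> * s \<le> 2 * \<theta>\<^sup>2" "\<theta>\<^sup>2 \<le> 2 * (\<alpha> + \<beta> * s)"
    using eta zero_le_power2[of \<theta>] unfolding abs_le_iff distrib_left by linarith+
  have "\<alpha> \<le> M / 2" "\<bar>\<beta>\<bar> \<le> M / 6"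
    using bound[of 2 "x - s"] bound[of 3 "x - s"] z by (auto simp: defs)
  moreover from this have "\<beta> * s \<le> M / 6"
    using s sR mult_mono[of \<beta> "M / 6" s 1] by auto
  ultimately have "\<theta>\<^sup>2 \<le> 2 * M" using eta2 M unfolding distrib_left by linarith
  also have "\<dots> \<le> (2 * M)\<^sup>2" using M by (simp add: power2_eq_square)
  finally have "\<theta> \<le> 2 * M" by (rule power2_le_imp_le) (use M in simp)
  then have "l * \<theta> \<le> l * (2 * M)" using M R by (intro mult_left_mono) (auto simp: defs)
  then have l\<theta>: "l * \<theta> \<le> R / 4" using M by (simp add: defs)
  have l: "0 < l" "l \<le> 1 / 8" using M R MR by (auto simp: defs field_simps)
  have l0: "0 < l * \<theta>" "l * \<theta> \<le> \<theta> / 8" using l \<theta> by auto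
  \<comment> \<open>the sign of \<open>\<beta>\<close> decides on which side of \<open>z\<close> the cubic term is unfavourable\<close>
  have le: "s + l * \<theta> \<le> \<theta>" "0 \<le> s + l * \<theta>" "- (l * \<theta>) \<noteq> 0" "\<bar>x - s + - (l * \<theta>) - x\<bar> \<le> R"
    using l0 s\<theta>' s(1) sR l\<theta> R by linarith+
  have "\<bar>\<beta>\<bar> * (l * \<theta>) \<le> (2 + M) * \<theta>\<^sup>2"
  proof (cases "\<beta> < 0")
    case True
    have "0 \<le> \<alpha> + \<beta> * (s + l * \<theta>) + M / 24 * (s + l * \<theta>)\<^sup>2"
      by (rule pos) (use l0 l\<theta> s R in auto)
    moreover have "M * (s + l * \<theta>)\<^sup>2 \<le> M * \<theta>\<^sup>2"
      using M le by (intro mult_left_mono power_mono) auto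
    moreover have "0 \<le> M * \<theta>\<^sup>2" using M by simp
    ultimately have "- (\<beta> * (l * \<theta>)) \<le> 2 * \<theta>\<^sup>2 + M * \<theta>\<^sup>2"
      using eta2 unfolding distrib_left by linarith
    then show ?thesis using True by (simp add: algebra_simps)
  next
    case False
    have "0 \<le> \<alpha> + \<beta> * (- (l * \<theta>)) + M / 24 * (- (l * \<theta>))\<^sup>2"
      by (rule pos[OF le(4,3)])
    moreover have "M * (- (l * \<theta>))\<^sup>2 \<le> M * \<theta>\<^sup>2"
      unfolding power2_minus
      using M s l0 \<theta> by (intro mult_left_mono power_mono) auto
    moreover have "0 \<le> M * \<theta>\<^sup>2" "0 \<le> \<beta> * s" using M False s by auto
    ultimately have "\<beta> * (l * \<theta>) \<le> 2 * \<theta>\<^sup>2 + M * \<theta>\<^sup>2"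
      using eta2 by simp
    then show ?thesis using False by (simp add: algebra_simps)
  qed
  then have "(\<bar>\<beta>\<bar> * l) * \<theta> \<le> ((2 + M) * \<theta>) * \<theta>" by (simp add: power2_eq_square mult_ac)
  then have "\<bar>\<beta>\<bar> * l \<le> (2 + M) * \<theta>" using \<theta> by simp
  then have "\<bar>\<beta>\<bar> \<le> (2 + M) * \<theta> / l" using l by (simp add: field_simps)
  also have "\<dots> = (K - 2) * \<theta>" by (simp add: K defs(4) mult_ac)
  finally have \<beta>: "\<bar>\<beta>\<bar> \<le> (K - 2) * \<theta>" .
  have MK: "M \<le> K"
  proof -
    have "M * 1 \<le> M * (8 * (2 + M) / R)"
      using M R by (intro mult_left_mono) (auto simp: field_simps)
    also have "\<dots> = K - 2" by (simp add: K)
    finally show ?thesis by simp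
  qed
  have "0 \<le> \<alpha>" using van by (simp add: defs)
  have "\<bar>\<beta> * s\<bar> \<le> (K - 2) * \<theta> * \<theta>"
    unfolding abs_mult using \<beta> s s\<theta>' \<theta> by (intro mult_mono) auto
  then have \<alpha>: "\<bar>\<alpha>\<bar> \<le> K * \<theta>\<^sup>2"
    using eta2 \<open>0 \<le> \<alpha>\<close> by (simp add: algebra_simps power2_eq_square)
  have \<beta>': "\<bar>\<beta>\<bar> \<le> K * \<theta>" using \<beta> \<theta> by (simp add: algebra_simps)
  define e0 e1 e2 where "e0 = F 0 x - (\<alpha> * s\<^sup>2 + \<beta> * s ^ 3)" "e1 = F 1 x - (2 * \<alpha> * s + 3 * \<beta> * s\<^sup>2)"
    "e2 = F 2 x - (2 * \<alpha> + 6 * \<beta> * s)"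
  note es = this
  have xz: "\<bar>x - s + s - x\<bar> \<le> R" using R by simp
  have F23: "F 2 (x - s) = 2 * \<alpha>" "F 3 (x - s) = 6 * \<beta>" by (auto simp: defs(2,3))
  have "\<bar>e0\<bar> \<le> M / 24 * s ^ 4" "\<bar>e1\<bar> \<le> M / 6 * s ^ 3" "\<bar>e2\<bar> \<le> M / 2 * s\<^sup>2"
    using taylor0[OF z(2) xz] taylor1[OF z(2) xz] taylor2[OF z(2) xz] s(1) unfolding van es F23
    by (simp_all add: mult_ac)
  moreover have "0 \<le> M * s ^ 4" "0 \<le> M * s ^ 3" "0 \<le> M * s\<^sup>2" using M s(1) by auto
  ultimately have "\<bar>e0\<bar> \<le> M * s ^ 4" "\<bar>e1\<bar> \<le> M * s ^ 3" "\<bar>e2\<bar> \<le> M * s\<^sup>2"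
    by linarith+
  moreover have "M * s ^ 4 \<le> K * s ^ 4" "M * s ^ 3 \<le> K * s ^ 3" "M * s\<^sup>2 \<le> K * s\<^sup>2"
    using MK s by (auto intro: mult_right_mono)
  ultimately have E: "\<bar>e0\<bar> \<le> K * s ^ 4" "\<bar>e1\<bar> \<le> K * s ^ 3" "\<bar>e2\<bar> \<le> K * s\<^sup>2"
    by linarith+
  have "s \<le> \<theta>" using s\<theta>' \<theta> by linarith
  from discriminant_at_distance[OF s(1) this \<alpha> \<beta>' E]
  show ?thesis by (simp add: es \<mu> \<mu>\<theta>)
qed

end

text \<open>
The sum of the constants of the two bounds for \<open>2 f f'' - f'\<^sup>2\<close>, with the threshold
\<open>c = R / (4 M)\<close> between them; the factor \<open>10\<close> absorbs \<open>3 / 4\<close> and \<open>40 / 4\<close>, where \<open>4\<close> comes from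
the denominator of \<open>a''\<close>.
\<close>

definition slope_const :: "real \<Rightarrow> real \<Rightarrow> real" where
  "slope_const M R = 10 * (54 / (R / (4 * M))\<^sup>2 + M + 2 + 8 * M * (2 + M) / R)\<^sup>2"

definition zero_const :: "real \<Rightarrow> real \<Rightarrow> real" where
  "zero_const M R = M\<^sup>2 / R + 2 * M"

context smooth_square
begin

lemma discriminant_bound:
  assumes "0 < a x"
  shows "\<bar>2 * F 0 x * F 2 x - (F 1 x)\<^sup>2\<bar> \<le> 4 * slope_const M R * (a x) ^ 3"
proof -
  define c \<mu> K1 K2 where "c = R / (4 * M)" "\<mu> = sqrt (a x)" "K1 = 54 / c\<^sup>2 + M"
    "K2 = 2 + 8 * M * (2 + M) / R"
  note defs = this
  have \<mu>: "0 < \<mu>" "a x = \<mu>\<^sup>2" using assms by (auto simp: defs)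
  have c: "0 < c" "c \<le> 1" using M R by (auto simp: defs)
  have K: "0 \<le> K1" "0 \<le> K2" using M R by (auto simp: defs)
  have S: "slope_const M R = 10 * (K1 + K2)\<^sup>2" by (simp add: slope_const_def defs add_ac)
  have KS: "3 * K1\<^sup>2 \<le> 4 * slope_const M R" "40 * K2\<^sup>2 \<le> 4 * slope_const M R"
  proof -
    have "K1\<^sup>2 \<le> (K1 + K2)\<^sup>2" "K2\<^sup>2 \<le> (K1 + K2)\<^sup>2" using K by (auto intro!: power_mono)
    moreover have "0 \<le> (K1 + K2)\<^sup>2" by simp
    ultimately show "3 * K1\<^sup>2 \<le> 4 * slope_const M R" "40 * K2\<^sup>2 \<le> 4 * slope_const M R"
      unfolding S by linarith+
  qed
  have F0: "F 0 x = \<mu> ^ 4"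
    using square[of x] \<mu> R by (simp add: eval_nat_numeral)
  have "\<mu> ^ 4 \<le> M ^ 4"
    using bound[of 0 x] F0 R M power_increasing[of 1 4 M] by auto
  then have "\<mu> \<le> M" using \<mu> M by (simp add: power_mono_iff)
  then have "c * \<mu> \<le> c * M" using c by simp
  then have c\<mu>: "c * \<mu> \<le> R" "0 < c * \<mu>" using M R c(1) \<mu>(1) by (simp_all add: defs(1))
  show ?thesis
  proof (cases "0 \<le> a (x - c * \<mu>)")
    case True
    have "\<bar>2 * F 0 x * F 2 x - (F 1 x)\<^sup>2\<bar> \<le> 3 * K1\<^sup>2 * (a x) ^ 3"
      by (rule discriminant_bound_no_zero[OF c \<mu>(1) c\<mu>(1) \<mu>(2) True defs(3)])
    also have "\<dots> \<le> 4 * slope_const M R * (a x) ^ 3"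
      using KS assms by (intro mult_right_mono) auto
    finally show ?thesis .
  next
    case False
    have "continuous_on {x - c * \<mu>..x} a"
      using c\<mu> by (intro continuous_on_subset[OF cont]) auto
    then obtain z where z: "x - c * \<mu> \<le> z" "z \<le> x" "a z = 0"
      using IVT'[of a "x - c * \<mu>" 0 x] False assms c\<mu> by auto
    then have "z \<noteq> x" using assms by auto
    have "\<bar>2 * F 0 x * F 2 x - (F 1 x)\<^sup>2\<bar> \<le> 40 * K2\<^sup>2 * (a x) ^ 3"
      by (rule discriminant_bound_near_zero[where s = "x - z" and c = c, OF _ _ \<mu> _ _ _ defs(4)])
         (use z c \<open>z \<noteq> x\<close> in \<open>auto simp: defs(1)\<close>)
    also have "\<dots> \<le> 4 * slope_const M R * (a x) ^ 3"
      using KS assms by (intro mult_right_mono) auto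
    finally show ?thesis .
  qed
qed

text \<open>
Here \<open>a\<^sup>2 = (\<omega>\<^sup>2 + \<beta> s) s\<^sup>2 + O(s\<^sup>4)\<close>.  Non-negativity on both sides at distance of order \<open>\<omega>\<close> gives
\<open>|\<beta>| = O(\<omega>)\<close>, so that \<open>|a|\<close> and \<open>\<omega> |s|\<close> differ by \<open>O(s\<^sup>2)\<close> although the square root is
singular at \<open>\<omega> = 0\<close>.  Monotonicity fixes the sign of \<open>a\<close>, hence the slope is the same
on both sides.
\<close>

lemma expansion_at_zero:
  assumes z: "a x = 0" and s: "\<bar>s\<bar> \<le> R"
  shows "\<bar>a (x + s) - sqrt (F 2 x / 2) * s\<bar> \<le> zero_const M R * s\<^sup>2"
proof -
  define \<omega> \<beta> K where "\<omega> = sqrt (F 2 x / 2)" "\<beta> = F 3 x / 6" "K = M / R + M"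
  note defs = this
  have x0: "\<bar>x - x\<bar> < R" "\<bar>x - x\<bar> \<le> R" using R by auto
  note van = vanishing[OF x0(1) z]
  have \<omega>: "0 \<le> \<omega>" "\<omega>\<^sup>2 = F 2 x / 2" using van by (auto simp: defs)
  have K: "0 \<le> K" using M R by (simp add: defs)
  have T0: "\<bar>(a (x + \<sigma>))\<^sup>2 - (\<omega>\<^sup>2 + \<beta> * \<sigma>) * \<sigma>\<^sup>2\<bar> \<le> M / 24 * \<sigma>\<^sup>2 * \<sigma>\<^sup>2" if "\<bar>\<sigma>\<bar> \<le> R" for \<sigma>
    using taylor0[OF x0(2), of \<sigma>] square[of "x + \<sigma>"] that unfolding van \<omega>
    by (simp add: defs algebra_simps eval_nat_numeral)
  have pos: "0 \<le> \<omega>\<^sup>2 + \<beta> * \<sigma> + M / 24 * \<sigma>\<^sup>2" if "\<bar>\<sigma>\<bar> \<le> R" "\<sigma> \<noteq> 0" for \<sigma>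
  proof -
    have "0 \<le> (a (x + \<sigma>))\<^sup>2" by simp
    then have "0 \<le> (\<omega>\<^sup>2 + \<beta> * \<sigma>) * \<sigma>\<^sup>2 + M / 24 * \<sigma>\<^sup>2 * \<sigma>\<^sup>2"
      using T0[OF that(1)] by linarith
    then have "0 \<le> \<sigma>\<^sup>2 * (\<omega>\<^sup>2 + \<beta> * \<sigma> + M / 24 * \<sigma>\<^sup>2)"
      by (simp add: algebra_simps)
    then show ?thesis using that(2) by (simp add: zero_le_mult_iff)
  qed
  have pos': "\<bar>\<beta>\<bar> * \<sigma> \<le> \<omega>\<^sup>2 + M / 24 * \<sigma>\<^sup>2" if "0 < \<sigma>" "\<sigma> \<le> R" for \<sigma>
  proof -
    have "\<bar>\<beta>\<bar> * \<sigma> = \<bar>\<beta> * \<sigma>\<bar>" using that by (simp add: abs_mult)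
    moreover have "0 \<le> \<omega>\<^sup>2 + \<beta> * \<sigma> + M / 24 * \<sigma>\<^sup>2" "0 \<le> \<omega>\<^sup>2 - \<beta> * \<sigma> + M / 24 * \<sigma>\<^sup>2"
      using pos[of \<sigma>] pos[of "- \<sigma>"] that by simp_all
    ultimately show ?thesis by linarith
  qed
  \<comment> \<open>a vanishing \<open>\<omega>\<close> leaves no length scale, and \<open>\<sigma> \<rightarrow> 0\<close> is used; otherwise \<open>\<sigma>\<close> is proportional to \<open>\<omega>\<close>\<close>
  have \<beta>: "\<bar>\<beta>\<bar> \<le> K * \<omega>"
  proof (cases "\<omega> = 0")
    case True
    have "\<bar>\<beta>\<bar> \<le> 0"
    proof (rule field_le_epsilon)
      fix e :: real assume e: "0 < e"
      define \<sigma> where "\<sigma> = min R (e / M)"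
      have \<sigma>: "0 < \<sigma>" "\<sigma> \<le> R" "M * \<sigma> \<le> e" using e M R mult_left_mono[of \<sigma> "e / M" M] by (auto simp: \<sigma>_def)
      have "\<bar>\<beta>\<bar> * \<sigma> \<le> (M / 24 * \<sigma>) * \<sigma>"
        using pos'[OF \<sigma>(1,2)] True by (simp add: power2_eq_square)
      then have "\<bar>\<beta>\<bar> \<le> M / 24 * \<sigma>" using \<sigma> by simp
      moreover have "0 \<le> M * \<sigma>" using M \<sigma> by simp
      ultimately show "\<bar>\<beta>\<bar> \<le> 0 + e" using \<sigma> by simp
    qed
    with True show ?thesis by simp
  next
    case False
    then have \<omega>0: "0 < \<omega>" using \<omega> by simp
    have "\<omega>\<^sup>2 \<le> M" using bound[of 2 x] x0 \<omega> M by auto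
    also have "\<dots> \<le> M\<^sup>2" using M by (simp add: power2_eq_square)
    finally have "\<omega> \<le> M" by (rule power2_le_imp_le) (use M in simp)
    then have \<sigma>: "0 < R / M * \<omega>" "R / M * \<omega> \<le> R"
      using M R \<omega>0 mult_left_mono[of \<omega> M "R / M"] by simp_all
    have "\<bar>\<beta>\<bar> * (R / M * \<omega>) \<le> \<omega>\<^sup>2 + M / 24 * (R / M * \<omega>)\<^sup>2"
      by (rule pos'[OF \<sigma>])
    also have "M / 24 * (R / M * \<omega>)\<^sup>2 = R / 24 * (R / M * \<omega>) * \<omega>"
      using M by (simp add: power2_eq_square)
    finally have "(\<bar>\<beta>\<bar> * (R / M)) * \<omega> \<le> (\<omega> + R / 24 * (R / M * \<omega>)) * \<omega>"
      by (simp add: power2_eq_square distrib_right)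
    then have "\<bar>\<beta>\<bar> * (R / M) \<le> \<omega> + R / 24 * (R / M * \<omega>)"
      using \<omega>0 by (rule mult_right_le_imp_le)
    then have "\<bar>\<beta>\<bar> * (R / M) * (M / R) \<le> (\<omega> + R / 24 * (R / M * \<omega>)) * (M / R)"
      using M R by (intro mult_right_mono) auto
    moreover have "(\<omega> + R / 24 * (R / M * \<omega>)) * (M / R) = M / R * \<omega> + R / 24 * \<omega>"
      using M R by (simp add: field_simps)
    moreover have "\<bar>\<beta>\<bar> * (R / M) * (M / R) = \<bar>\<beta>\<bar>" using M R by simp
    ultimately have "\<bar>\<beta>\<bar> \<le> M / R * \<omega> + R / 24 * \<omega>" by simp
    also have "\<dots> \<le> M / R * \<omega> + M * \<omega>"
      using M R \<omega>0 by (intro add_mono mult_right_mono) auto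
    finally show ?thesis by (simp add: defs algebra_simps)
  qed
  define b where "b = \<bar>a (x + s)\<bar>"
  have sgn: "a (x + s) - \<omega> * s = sgn s * (b - \<omega> * \<bar>s\<bar>)"
    using mono[of x "x + s"] mono[of "x + s" x] z s R
    by (cases s "0 :: real" rule: linorder_cases) (auto simp: b_def)
  have main: "\<bar>b - \<omega> * \<bar>s\<bar>\<bar> \<le> (K + M) * s\<^sup>2"
  proof (rule ccontr)
    assume "\<not> ?thesis"
    then have D: "(K + M) * s\<^sup>2 < \<bar>b - \<omega> * \<bar>s\<bar>\<bar>" by simp
    define S where "S = b + \<omega> * \<bar>s\<bar>"
    have b0: "0 \<le> b" by (simp add: b_def)
    have w0: "0 \<le> \<omega> * \<bar>s\<bar>" using \<omega> by simp
    have S: "\<omega> * \<bar>s\<bar> \<le> S" "\<bar>b - \<omega> * \<bar>s\<bar>\<bar> \<le> S" using b0 w0 by (auto simp: S_def)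
    have KM: "0 \<le> (K + M) * s\<^sup>2" "1 * s\<^sup>2 \<le> (K + M) * s\<^sup>2"
      using K M mult_right_mono[of 1 "K + M" "s\<^sup>2"] by auto
    have S0: "0 < S" "s\<^sup>2 \<le> S" using S D KM by linarith+
    have "(K * s\<^sup>2 + M * s\<^sup>2) * S < \<bar>b - \<omega> * \<bar>s\<bar>\<bar> * S"
      using mult_strict_right_mono[OF D S0(1)] by (simp only: distrib_right)
    also have "\<dots> = \<bar>(b - \<omega> * \<bar>s\<bar>) * S\<bar>" using S0 by (simp add: abs_mult)
    also have "(b - \<omega> * \<bar>s\<bar>) * S = (a (x + s))\<^sup>2 - \<omega>\<^sup>2 * s\<^sup>2"
      by (simp add: S_def b_def algebra_simps power2_eq_square)
    also have "\<bar>\<dots>\<bar> \<le> \<bar>\<beta> * s * s\<^sup>2\<bar> + M / 24 * s\<^sup>2 * s\<^sup>2"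
      using T0[OF s] unfolding distrib_right by linarith
    also have "\<bar>\<beta> * s * s\<^sup>2\<bar> = \<bar>\<beta>\<bar> * \<bar>s\<bar> * s\<^sup>2" by (simp add: abs_mult)
    also have "\<dots> \<le> (K * \<omega>) * \<bar>s\<bar> * s\<^sup>2" using \<beta> by (intro mult_right_mono) auto
    also have "\<dots> = K * s\<^sup>2 * (\<omega> * \<bar>s\<bar>)" by simp
    also have "\<dots> \<le> K * s\<^sup>2 * S" using S K by (intro mult_left_mono) auto
    also have "M / 24 * s\<^sup>2 * s\<^sup>2 \<le> M * s\<^sup>2 * S"
      using M S0 by (intro mult_mono) auto
    finally show False by (simp add: algebra_simps)
  qed
  have "\<bar>sgn s * (b - \<omega> * \<bar>s\<bar>)\<bar> \<le> (K + M) * s\<^sup>2"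
    using main by (cases "s = 0") (auto simp: abs_mult sgn_if)
  also have "\<dots> \<le> zero_const M R * s\<^sup>2"
  proof (rule mult_right_mono)
    have "M / R \<le> M\<^sup>2 / R" using M R by (auto simp: power2_eq_square intro!: divide_right_mono)
    then show "K + M \<le> zero_const M R" by (simp add: defs zero_const_def)
  qed simp
  finally show ?thesis using sgn by (simp add: defs)
qed

text \<open>
Differentiating \<open>a = sqrt (F 0)\<close> twice produces the discriminant bounded above.
\<close>

lemma nonzero_derivatives:
  assumes t: "\<bar>t - x\<bar> < R" and pos: "0 < a t"
  defines "d \<equiv> (\<lambda>t. F 1 t / (2 * a t))"
  shows "(a has_real_derivative d t) (at t)"
    and "(d has_real_derivative (2 * F 0 t * F 2 t - (F 1 t)\<^sup>2) / (4 * (a t) ^ 3)) (at t)"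
proof -
  have tR: "\<bar>t - x\<bar> \<le> R" using t by simp
  have "continuous_on {x - R<..<x + R} a"
    by (rule continuous_on_subset[OF cont]) auto
  then have "isCont a t"
    using t by (subst (asm) continuous_on_eq_continuous_at) (auto simp: abs_less_iff)
  then have "\<forall>\<^sub>F s in nhds t. 0 < a s"
    using pos order_tendstoD(1)[of a "a t" "nhds t" 0] by (auto simp: isCont_def tendsto_at_iff_tendsto_nhds)
  moreover have "\<forall>\<^sub>F s in nhds t. s \<in> {x - R<..<x + R}"
    using t by (intro eventually_nhds_in_open) (auto simp: abs_less_iff)
  ultimately have ev: "\<forall>\<^sub>F s in nhds t. sqrt (F 0 s) = a s"
    by eventually_elim (auto simp: square abs_le_iff)
  have F0: "F 0 t = (a t)\<^sup>2" "0 < F 0 t" using square[OF tR] pos by auto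
  have "((\<lambda>s. sqrt (F 0 s)) has_real_derivative d t) (at t)"
    using DERIV_chain2[OF DERIV_real_sqrt[OF F0(2)] deriv[OF _ tR, of 0]] F0 pos
    by (simp add: d_def field_simps)
  then show da: "(a has_real_derivative d t) (at t)"
    using DERIV_cong_ev[OF refl ev refl] by simp
  have d1: "(F 1 has_real_derivative F 2 t) (at t)"
    using deriv[OF _ tR, of 1] by (simp add: numeral_2_eq_2)
  have "(d has_real_derivative (F 2 t * (2 * a t) - F 1 t * (2 * d t)) / (2 * a t * (2 * a t))) (at t)"
    unfolding d_def using pos
    by (intro DERIV_divide d1 DERIV_cmult da[unfolded d_def]) auto
  also have "(F 2 t * (2 * a t) - F 1 t * (2 * d t)) / (2 * a t * (2 * a t))
      = (2 * F 0 t * F 2 t - (F 1 t)\<^sup>2) / (4 * (a t) ^ 3)"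
    using pos F0 by (simp add: d_def field_simps power2_eq_square power3_eq_cube)
  finally show "(d has_real_derivative (2 * F 0 t * F 2 t - (F 1 t)\<^sup>2) / (4 * (a t) ^ 3)) (at t)" .
qed

lemma slope_lipschitz_where_positive:
  assumes st: "\<bar>s - x\<bar> \<le> R / 2" "\<bar>t - x\<bar> \<le> R / 2" and pos: "0 < a s" "0 < a t"
    and C: "C = slope_const M (R / 2)"
  shows "\<bar>F 1 s / (2 * a s) - F 1 t / (2 * a t)\<bar> \<le> C * \<bar>s - t\<bar>"
proof -
  have *: "\<bar>F 1 s / (2 * a s) - F 1 t / (2 * a t)\<bar> \<le> C * (t - s)"
    if st: "s < t" "\<bar>s - x\<bar> \<le> R / 2" "\<bar>t - x\<bar> \<le> R / 2" and pos: "0 < a s" for s t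
  proof -
    have apos: "0 < a w" if "s \<le> w" "w \<le> t" for w
    proof -
      have "\<bar>s - x\<bar> \<le> R" "\<bar>w - x\<bar> \<le> R" using that st(2,3) R(1) unfolding abs_le_iff by auto
      then show ?thesis using mono[of s w] pos that by simp
    qed
    have "\<exists>w>s. w < t \<and> F 1 t / (2 * a t) - F 1 s / (2 * a s)
        = (t - s) * ((2 * F 0 w * F 2 w - (F 1 w)\<^sup>2) / (4 * (a w) ^ 3))"
    proof (rule MVT2[OF st(1)])
      fix w assume w: "s \<le> w" "w \<le> t"
      have "\<bar>w - x\<bar> < R" using w st(2,3) R(1) unfolding abs_le_iff by (auto simp: abs_less_iff)
      then show "((\<lambda>t. F 1 t / (2 * a t)) has_real_derivative
          (2 * F 0 w * F 2 w - (F 1 w)\<^sup>2) / (4 * (a w) ^ 3)) (at w)"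
        using apos[OF w] by (rule nonzero_derivatives(2))
    qed
    then obtain w where w: "s < w" "w < t" and eq: "F 1 t / (2 * a t) - F 1 s / (2 * a s)
        = (t - s) * ((2 * F 0 w * F 2 w - (F 1 w)\<^sup>2) / (4 * (a w) ^ 3))"
      by blast
    have aw: "0 < a w" using apos w by simp
    have wR: "\<bar>w - x\<bar> \<le> R / 2" using w st(2,3) unfolding abs_le_iff by auto
    interpret w: smooth_square F a M "R / 2" w
      by (rule restrict) (use wR R in auto)
    have "\<bar>(2 * F 0 w * F 2 w - (F 1 w)\<^sup>2) / (4 * (a w) ^ 3)\<bar>
        = \<bar>2 * F 0 w * F 2 w - (F 1 w)\<^sup>2\<bar> / (4 * (a w) ^ 3)"
      using aw by (simp add: abs_divide)
    also have "\<dots> \<le> 4 * C * (a w) ^ 3 / (4 * (a w) ^ 3)"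
      using w.discriminant_bound[OF aw] aw unfolding C by (intro divide_right_mono) auto
    also have "\<dots> = C" using aw by simp
    finally have "\<bar>(t - s) * ((2 * F 0 w * F 2 w - (F 1 w)\<^sup>2) / (4 * (a w) ^ 3))\<bar> \<le> (t - s) * C"
      unfolding abs_mult using st by (intro mult_mono) auto
    then show ?thesis unfolding eq[symmetric] by (simp add: mult.commute abs_minus_commute)
  qed
  show ?thesis
  proof (cases s t rule: linorder_cases)
    case less
    then show ?thesis using *[OF less st pos(1)] by simp
  next
    case greater
    then show ?thesis using *[OF greater st(2,1) pos(2)] by (simp add: abs_minus_commute)
  qed simp
qed

lemma expansion_where_positive:
  assumes pos: "0 < a x" and t: "\<bar>t\<bar> \<le> R / 2"
    and apos: "\<And>w. w \<in> open_segment x (x + t) \<Longrightarrow> 0 < a w"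
    and C: "C = slope_const M (R / 2)"
  shows "\<bar>a (x + t) - a x - F 1 x / (2 * a x) * t\<bar> \<le> C * t\<^sup>2"
proof (cases "t = 0")
  case False
  define p q where "p = min x (x + t)" "q = max x (x + t)"
  have pq: "p < q" "{p<..<q} = open_segment x (x + t)" "{p..q} \<subseteq> {x - R..x + R}"
    using False t R by (auto simp: p_q_def open_segment_eq_real_ivl)
  have seg: "w \<in> open_segment x (x + t)" "\<bar>w - x\<bar> \<le> \<bar>t\<bar>" if "p < w" "w < q" for w
  proof -
    show "w \<in> open_segment x (x + t)" using that unfolding pq(2)[symmetric] by simp
    show "\<bar>w - x\<bar> \<le> \<bar>t\<bar>"
      using that unfolding p_q_def by (cases "t < 0") auto
  qed
  obtain w where w: "p < w" "w < q" "a q - a p = (q - p) * (F 1 w / (2 * a w))"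
  proof -
    have "continuous_on {p..q} a" by (rule continuous_on_subset[OF cont pq(3)])
    moreover have "(a has_derivative (*) (F 1 w / (2 * a w))) (at w)" if "p < w" "w < q" for w
    proof -
      have "\<bar>w - x\<bar> < R" using seg(2)[OF that] t R(1) by linarith
      then have "(a has_real_derivative F 1 w / (2 * a w)) (at w)"
        using apos[OF seg(1)[OF that]] by (rule nonzero_derivatives(1))
      then show ?thesis by (simp add: has_field_derivative_def)
    qed
    ultimately obtain w where "p < w" "w < q" "a q - a p = F 1 w / (2 * a w) * (q - p)"
      using mvt[OF pq(1), of a "\<lambda>w. (*) (F 1 w / (2 * a w))"] by blast
    then show ?thesis by (intro that) (simp_all add: mult.commute)
  qed
  have "a (x + t) - a x = F 1 w / (2 * a w) * t"
    using w(3) by (cases "t < 0") (auto simp: p_q_def algebra_simps)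
  then have "a (x + t) - a x - F 1 x / (2 * a x) * t = (F 1 w / (2 * a w) - F 1 x / (2 * a x)) * t"
    by (simp add: algebra_simps)
  also have "\<bar>\<dots>\<bar> \<le> (C * \<bar>w - x\<bar>) * \<bar>t\<bar>"
    unfolding abs_mult
  proof (rule mult_right_mono)
    have "\<bar>w - x\<bar> \<le> R / 2" "\<bar>x - x\<bar> \<le> R / 2" using seg(2)[OF w(1,2)] t R(1) by simp_all
    then show "\<bar>F 1 w / (2 * a w) - F 1 x / (2 * a x)\<bar> \<le> C * \<bar>w - x\<bar>"
      using apos[OF seg(1)[OF w(1,2)]] pos C by (rule slope_lipschitz_where_positive)
  qed simp
  also have "\<dots> \<le> (C * \<bar>t\<bar>) * \<bar>t\<bar>"
  proof -
    have "0 \<le> C" unfolding C slope_const_def by simp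
    moreover note seg(2)[OF w(1,2)]
    ultimately show ?thesis by (intro mult_right_mono mult_left_mono) auto
  qed
  also have "\<dots> = C * t\<^sup>2" by (simp add: power2_eq_square flip: abs_mult)
  finally show ?thesis .
qed simp

text \<open>
If \<open>a\<close> stays positive between the two points, this is the mean value theorem.  Otherwise let \<open>z\<close> be
the zero nearest to \<open>x\<close>.  The expansions of \<open>a\<close> at \<open>x\<close> and at \<open>z\<close> both relate the values at \<open>x\<close>
and \<open>z\<close>, so that their slopes \<open>d\<close> and \<open>e\<close> differ by \<open>O(|x - z|)\<close>; the expansion at \<open>z\<close> then
reaches every point beyond \<open>z\<close>.
\<close>

lemma expansion_at_positive:
  assumes pos: "0 < a x" and t: "\<bar>t\<bar> \<le> R / 2"
    and C: "C = slope_const M (R / 2)" "Z = zero_const M (R / 2)"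
  shows "\<bar>a (x + t) - a x - F 1 x / (2 * a x) * t\<bar> \<le> (C + 3 * Z) * t\<^sup>2"
proof -
  have Z0: "0 \<le> Z" unfolding C zero_const_def using M R by simp
  show ?thesis
  proof (cases "0 < a (x + t)")
    case True
    have "0 < a w" if "w \<in> open_segment x (x + t)" for w
    proof -
      have "x \<le> w \<or> x + t \<le> w" "\<bar>w - x\<bar> \<le> \<bar>t\<bar>"
        using that by (auto simp: open_segment_eq_real_ivl split: if_splits)
      moreover from this have "\<bar>w - x\<bar> \<le> R" "\<bar>x + t - x\<bar> \<le> R" "\<bar>x - x\<bar> \<le> R" using t R by simp_all
      ultimately show ?thesis
        using pos True mono[of x w] mono[of "x + t" w] by auto
    qed
    from expansion_where_positive[OF pos t this C(1)]
    have "\<bar>a (x + t) - a x - F 1 x / (2 * a x) * t\<bar> \<le> C * t\<^sup>2" .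
    also have "\<dots> \<le> (C + 3 * Z) * t\<^sup>2" using Z0 by (intro mult_right_mono) auto
    finally show ?thesis .
  next
    case False
    then have "t < 0" using mono[of x "x + t"] pos t R by (cases "0 \<le> t") auto
    have cts: "continuous_on {x + t..x} a"
      using t R \<open>t < 0\<close> by (intro continuous_on_subset[OF cont]) auto
    define zs where "zs = {x + t..x} \<inter> a -` {0}"
    have "closed zs"
      unfolding zs_def by (rule continuous_closed_preimage[OF cts]) auto
    moreover have "bounded zs" by (rule bounded_subset[of "{x + t..x}"]) (auto simp: zs_def)
    ultimately have "compact zs" by (simp add: compact_eq_bounded_closed)
    moreover have "zs \<noteq> {}"
      using IVT'[of a "x + t" 0 x] False pos \<open>t < 0\<close> cts by (auto simp: zs_def)
    ultimately obtain z where z: "z \<in> zs" "\<And>w. w \<in> zs \<Longrightarrow> w \<le> z"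
      using compact_attains_sup[of zs] by blast
    have zx: "x + t \<le> z" "z < x" "a z = 0"
      using z(1) pos by (auto simp: zs_def intro: order.not_eq_order_implies_strict)
    have apos: "0 < a w" if "w \<in> open_segment x (x + (z - x))" for w
    proof -
      have w: "z < w" "w < x" using that zx by (auto simp: open_segment_eq_real_ivl split: if_splits)
      then have "w \<notin> zs" using z(2)[of w] by auto
      then have "a w \<noteq> 0" using w zx by (auto simp: zs_def)
      moreover have "a z \<le> a w" using w zx t R by (intro mono) auto
      ultimately show ?thesis using zx by simp
    qed
    define d e s where "d = F 1 x / (2 * a x)" "e = sqrt (F 2 z / 2)" "s = x - z"
    have s: "0 < s" "s \<le> - t" "\<bar>z - x\<bar> \<le> R / 2" using zx t \<open>t < 0\<close> by (auto simp: d_e_s_def)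
    have 1: "\<bar>d * s - a x\<bar> \<le> C * s\<^sup>2"
    proof -
      have "\<bar>z - x\<bar> \<le> R / 2" using s by simp
      from expansion_where_positive[OF pos this apos C(1)] zx(3)
      have "\<bar>- a x - d * (z - x)\<bar> \<le> C * (z - x)\<^sup>2" by (simp add: d_e_s_def(1))
      also have "- a x - d * (z - x) = d * s - a x" by (simp add: d_e_s_def(3) algebra_simps)
      also have "(z - x)\<^sup>2 = s\<^sup>2" by (simp add: d_e_s_def(3) power2_commute)
      finally show ?thesis .
    qed
    interpret z: smooth_square F a M "R / 2" z
      by (rule restrict) (use s R in auto)
    have 2: "\<bar>a x - e * s\<bar> \<le> Z * s\<^sup>2"
      using z.expansion_at_zero[OF zx(3), of s] s unfolding C by (simp add: d_e_s_def)
    have 3: "\<bar>a (x + t) - e * (s + t)\<bar> \<le> Z * (s + t)\<^sup>2"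
      using z.expansion_at_zero[OF zx(3), of "s + t"] s t unfolding C by (simp add: d_e_s_def)
    have "\<bar>(d - e) * s\<bar> \<le> ((C + Z) * s) * s"
      using 1 2 by (simp add: algebra_simps power2_eq_square)
    then have 4: "\<bar>d - e\<bar> \<le> (C + Z) * s" using s by (simp add: abs_mult)
    have "\<bar>(d - e) * t\<bar> \<le> ((C + Z) * s) * (- t)"
      unfolding abs_mult using 4 s by (intro mult_mono) auto
    also have "\<dots> \<le> ((C + Z) * (- t)) * (- t)"
    proof -
      have "0 \<le> C" unfolding C slope_const_def by simp
      then show ?thesis using s Z0 by (intro mult_right_mono mult_left_mono) auto
    qed
    finally have 5: "\<bar>(d - e) * t\<bar> \<le> C * t\<^sup>2 + Z * t\<^sup>2" by (simp add: algebra_simps power2_eq_square)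
    have 6: "Z * s\<^sup>2 \<le> Z * t\<^sup>2" "Z * (s + t)\<^sup>2 \<le> Z * t\<^sup>2"
      using s Z0 by (auto intro!: mult_left_mono simp: abs_le_square_iff[symmetric])
    have "a (x + t) - a x - d * t = (a (x + t) - e * (s + t)) - (a x - e * s) - (d - e) * t"
      by (simp add: algebra_simps)
    then have "\<bar>a (x + t) - a x - d * t\<bar> \<le> C * t\<^sup>2 + 3 * (Z * t\<^sup>2)"
      using 2 3 5 6 by linarith
    then show ?thesis by (simp add: d_e_s_def algebra_simps)
  qed
qed

end

theorem monotone_root_expansion:
  assumes "1 \<le> M" "0 < R" "R \<le> 1"
  obtains C where "\<And>F a x. smooth_square F a M R x \<Longrightarrow>
    \<exists>d. \<forall>t. \<bar>t\<bar> \<le> R / 2 \<longrightarrow> \<bar>a (x + t) - a x - d * t\<bar> \<le> C * t\<^sup>2"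
proof
  fix F a x assume "smooth_square F a M R x"
  then interpret smooth_square F a M R x .
  interpret h: smooth_square F a M "R / 2" x by (rule restrict) (use R in auto)
  interpret m: smooth_square "\<lambda>k t. (-1) ^ k * F k (- t)" "\<lambda>t. - a (- t)" M R "- x"
    by (rule reflect)
  define C Z where "C = slope_const M (R / 2)" "Z = zero_const M (R / 2)"
  have Z0: "0 \<le> Z" unfolding C_Z_def zero_const_def using M R by simp
  have C0: "0 \<le> C" unfolding C_Z_def slope_const_def by simp
  consider "a x = 0" | "0 < a x" | "a x < 0" by linarith
  then have "\<exists>d. \<forall>t. \<bar>t\<bar> \<le> R / 2 \<longrightarrow> \<bar>a (x + t) - a x - d * t\<bar> \<le> (C + 3 * Z) * t\<^sup>2"
  proof cases
    case 1
    have "Z * t\<^sup>2 \<le> (C + 3 * Z) * t\<^sup>2" for t using C0 Z0 by (intro mult_right_mono) auto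
    then show ?thesis
      using h.expansion_at_zero[OF 1] 1 unfolding C_Z_def by (intro exI[of _ "sqrt (F 2 x / 2)"]) (auto intro: order_trans)
  next
    case 2
    then show ?thesis using expansion_at_positive[OF 2 _ C_Z_def] by blast
  next
    case 3
    then have 3: "0 < - a (- (- x))" by simp
    show ?thesis
    proof (intro exI allI impI)
      fix t assume "\<bar>t\<bar> \<le> R / 2"
      then have "\<bar>- t\<bar> \<le> R / 2" by simp
      from m.expansion_at_positive[OF 3 this C_Z_def]
      show "\<bar>a (x + t) - a x - (F 1 x / (2 * a x)) * t\<bar> \<le> (C + 3 * Z) * t\<^sup>2"
        by (simp add: abs_le_iff add.commute[of t x])
    qed
  qed
  then show "\<exists>d. \<forall>t. \<bar>t\<bar> \<le> R / 2 \<longrightarrow> \<bar>a (x + t) - a x - d * t\<bar> \<le>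
     (slope_const M (R / 2) + 3 * zero_const M (R / 2)) * t\<^sup>2"
    unfolding C_Z_def .
qed

section \<open>From expansions along lines to differentiability of the gradient\<close>

definition third_difference :: "('a::real_vector \<Rightarrow> real) \<Rightarrow> 'a \<Rightarrow> 'a \<Rightarrow> real" where
  "third_difference u x h = u (x + 3 *\<^sub>R h) - 3 * u (x + 2 *\<^sub>R h) + 3 * u (x + h) - u x"

lemma third_difference_lattice:
  "third_difference u (x + a *\<^sub>R h + b *\<^sub>R k) (c *\<^sub>R h + d *\<^sub>R k)
    = u (x + (a + 3 * c) *\<^sub>R h + (b + 3 * d) *\<^sub>R k) - 3 * u (x + (a + 2 * c) *\<^sub>R h + (b + 2 * d) *\<^sub>R k)
      + 3 * u (x + (a + c) *\<^sub>R h + (b + d) *\<^sub>R k) - u (x + a *\<^sub>R h + b *\<^sub>R k)"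
  by (simp add: third_difference_def scaleR_add_left scaleR_add_right add_ac)

text \<open>
An instance of Djokovic's identity, which writes the mixed difference in directions
\<open>h\<^sub>1, \<dots>, h\<^sub>n\<close> as a signed sum, over the subsets \<open>I\<close> of the indices, of \<open>n\<close>-fold differences with
the single step \<open>- (\<Sum>j\<in>I. h\<^sub>j / j)\<close> at the base point \<open>x + (\<Sum>j\<in>I. h\<^sub>j)\<close>.  Here \<open>n = 3\<close> and
the directions are \<open>h, h, k\<close>; the empty subset contributes nothing.
\<close>

lemma mixed_third_difference:
  fixes u :: "'a::real_vector \<Rightarrow> real" and x h k :: 'a
  defines "D \<equiv> \<lambda>a b c d. third_difference u (x + a *\<^sub>R h + b *\<^sub>R k) (c *\<^sub>R h + d *\<^sub>R k)"
  shows "u (x + 2 *\<^sub>R h + k) - 2 * u (x + h + k) + u (x + k) - (u (x + 2 *\<^sub>R h) - 2 * u (x + h) + u x)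
    = - D 1 0 (-1) 0 - D 1 0 (-1/2) 0 - D 0 1 0 (-1/3) + D 2 0 (-3/2) 0
      + D 1 1 (-1) (-1/3) + D 1 1 (-1/2) (-1/3) - D 2 1 (-3/2) (-1/3)"
  unfolding D_def third_difference_lattice by simp

text \<open>
The Taylor expansion is assumed on each ray separately: \<open>q x\<close> is positively homogeneous of degree
two, but not known to be a quadratic form, and nothing is known about its dependence on \<open>x\<close>.
\<close>

locale directional_taylor =
  fixes u :: "'a::euclidean_space \<Rightarrow> real" and Du q :: "'a \<Rightarrow> 'a \<Rightarrow> real" and C R \<rho> :: real
  assumes C: "0 \<le> C" and R: "0 < R"
    and linear_Du: "\<And>x. norm x < \<rho> \<Longrightarrow> linear (Du x)"
    and q_homogeneous: "\<And>x h s. 0 \<le> s \<Longrightarrow> q x (s *\<^sub>R h) = s\<^sup>2 * q x h"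
    and expansion: "\<And>x h. norm x < \<rho> \<Longrightarrow> norm h \<le> R \<Longrightarrow>
      \<bar>u (x + h) - u x - Du x h - q x h / 2\<bar> \<le> C * norm h ^ 3"
begin

lemma third_difference_bound:
  assumes "norm x < \<rho>" "3 * norm h \<le> R"
  shows "\<bar>third_difference u x h\<bar> \<le> 54 * (C * norm h ^ 3)"
proof -
  have "\<bar>u (x + 3 *\<^sub>R h) - u x - 3 * Du x h - 9 / 2 * q x h\<bar> \<le> 27 * (C * norm h ^ 3)"
    using expansion[OF assms(1), of "3 *\<^sub>R h"] assms
    by (simp add: linear_Du linear_cmul q_homogeneous power_mult_distrib)
  moreover have "\<bar>u (x + 2 *\<^sub>R h) - u x - 2 * Du x h - 2 * q x h\<bar> \<le> 8 * (C * norm h ^ 3)"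
    using expansion[OF assms(1), of "2 *\<^sub>R h"] assms norm_ge_zero[of h]
    by (simp add: linear_Du linear_cmul q_homogeneous power_mult_distrib)
  moreover have "\<bar>u (x + h) - u x - Du x h - q x h / 2\<bar> \<le> C * norm h ^ 3"
    using expansion[OF assms(1), of h] assms norm_ge_zero[of h] by simp
  ultimately show ?thesis
    unfolding third_difference_def abs_le_iff by linarith
qed

lemma mixed_difference_bound:
  assumes h: "norm h \<le> t" and k: "norm k \<le> t" and t: "norm x + 3 * t < \<rho>" "6 * t \<le> R"
  shows "\<bar>u (x + 2 *\<^sub>R h + k) - 2 * u (x + h + k) + u (x + k) - (u (x + 2 *\<^sub>R h) - 2 * u (x + h) + u x)\<bar>
    \<le> 3024 * (C * t ^ 3)"
proof -
  have t0: "0 \<le> t" using h norm_ge_zero order_trans by blast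
  have D: "\<bar>third_difference u (x + a *\<^sub>R h + b *\<^sub>R k) (c *\<^sub>R h + d *\<^sub>R k)\<bar> \<le> 432 * (C * t ^ 3)"
    if "0 \<le> a" "0 \<le> b" "a + b \<le> 3" "\<bar>c\<bar> + \<bar>d\<bar> \<le> 2" for a b c d
  proof -
    have 1: "norm (e *\<^sub>R h + f *\<^sub>R k) \<le> (\<bar>e\<bar> + \<bar>f\<bar>) * t" for e f
    proof -
      have "norm (e *\<^sub>R h + f *\<^sub>R k) \<le> \<bar>e\<bar> * norm h + \<bar>f\<bar> * norm k"
        by (rule order_trans[OF norm_triangle_ineq]) simp
      also have "\<dots> \<le> \<bar>e\<bar> * t + \<bar>f\<bar> * t" using h k by (intro add_mono mult_left_mono) auto
      finally show ?thesis by (simp add: distrib_right)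
    qed
    have "norm (x + a *\<^sub>R h + b *\<^sub>R k) \<le> norm x + norm (a *\<^sub>R h + b *\<^sub>R k)"
      unfolding add.assoc by (rule norm_triangle_ineq)
    also have "norm (a *\<^sub>R h + b *\<^sub>R k) \<le> (a + b) * t" using 1[of a b] that by simp
    also have "\<dots> \<le> 3 * t" using that t0 by (intro mult_right_mono) auto
    finally have x: "norm (x + a *\<^sub>R h + b *\<^sub>R k) < \<rho>" using t by simp
    have cd: "norm (c *\<^sub>R h + d *\<^sub>R k) \<le> 2 * t"
      using 1[of c d] mult_right_mono[OF that(4) t0] by simp
    have "\<bar>third_difference u (x + a *\<^sub>R h + b *\<^sub>R k) (c *\<^sub>R h + d *\<^sub>R k)\<bar>
        \<le> 54 * (C * norm (c *\<^sub>R h + d *\<^sub>R k) ^ 3)"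
      by (rule third_difference_bound[OF x]) (use cd t in linarith)
    also have "\<dots> \<le> 54 * (C * (2 * t) ^ 3)"
      using cd C by (intro mult_left_mono power_mono) auto
    finally show ?thesis by (simp add: power_mult_distrib)
  qed
  note D' = D[of 1 0 "-1" 0] D[of 1 0 "-1/2" 0] D[of 0 1 0 "-1/3"] D[of 2 0 "-3/2" 0]
    D[of 1 1 "-1" "-1/3"] D[of 1 1 "-1/2" "-1/3"] D[of 2 1 "-3/2" "-1/3"]
  show ?thesis
    unfolding mixed_third_difference
    by (rule abs_leI; insert D'; simp only: abs_le_iff; simp)
qed

lemma second_difference:
  assumes "norm x < \<rho>" "norm h \<le> t" "2 * t \<le> R"
  shows "\<bar>u (x + 2 *\<^sub>R h) - 2 * u (x + h) + u x - q x h\<bar> \<le> 10 * (C * t ^ 3)"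
proof -
  have t0: "0 \<le> t" using assms norm_ge_zero order_trans by blast
  have "\<bar>u (x + 2 *\<^sub>R h) - u x - 2 * Du x h - 2 * q x h\<bar> \<le> 8 * (C * norm h ^ 3)"
    using expansion[OF assms(1), of "2 *\<^sub>R h"] assms
    by (simp add: linear_Du linear_cmul q_homogeneous power_mult_distrib)
  moreover have "\<bar>u (x + h) - u x - Du x h - q x h / 2\<bar> \<le> C * norm h ^ 3"
    using expansion[OF assms(1), of h] assms t0 by simp
  moreover have "C * norm h ^ 3 \<le> C * t ^ 3"
    using assms C by (intro mult_left_mono power_mono) auto
  ultimately show ?thesis unfolding abs_le_iff by linarith
qed

text \<open>
The second differences with step \<open>h\<close> at \<open>x + k\<close> and at \<open>x\<close> approximate \<open>q (x + k) h\<close> and \<open>q x h\<close>,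
and they differ by a mixed third difference.
\<close>

lemma q_close:
  assumes h: "norm h \<le> t" and k: "norm k \<le> t" and t: "norm x + 3 * t < \<rho>" "6 * t \<le> R"
  shows "\<bar>q (x + k) h - q x h\<bar> \<le> 3044 * (C * t ^ 3)"
proof -
  have t0: "0 \<le> t" using h norm_ge_zero order_trans by blast
  have x: "norm x < \<rho>" "norm (x + k) < \<rho>"
    using norm_triangle_ineq[of x k] k t t0 by linarith+
  have 1: "\<bar>u (x + k + 2 *\<^sub>R h) - 2 * u (x + k + h) + u (x + k) - q (x + k) h\<bar> \<le> 10 * (C * t ^ 3)"
    by (rule second_difference[OF x(2) h]) (use t t0 in auto)
  have 2: "\<bar>u (x + 2 *\<^sub>R h) - 2 * u (x + h) + u x - q x h\<bar> \<le> 10 * (C * t ^ 3)"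
    by (rule second_difference[OF x(1) h]) (use t t0 in auto)
  have eq: "x + k + 2 *\<^sub>R h = x + 2 *\<^sub>R h + k" "x + k + h = x + h + k" by (simp_all add: add_ac)
  show ?thesis
    using 1 2 mixed_difference_bound[OF assms] unfolding eq abs_le_iff by linarith
qed

lemma q_lipschitz:
  assumes x: "norm x + 3 * norm k < \<rho>" "6 * norm k \<le> R"
  shows "\<bar>q (x + k) h - q x h\<bar> \<le> 3044 * C * norm k * (norm h)\<^sup>2"
proof (cases "h = 0 \<or> k = 0")
  case True
  then show ?thesis using q_homogeneous[of 0 _ 0] by auto
next
  case False
  define t s where "t = norm k" "s = norm k / norm h"
  have ts: "0 < t" "0 < s" "norm (s *\<^sub>R h) = t" "t = s * norm h" using False by (auto simp: t_s_def)
  have "\<bar>q (x + k) (s *\<^sub>R h) - q x (s *\<^sub>R h)\<bar> \<le> 3044 * (C * t ^ 3)"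
    by (rule q_close) (use ts x in \<open>auto simp: t_s_def\<close>)
  then have "s\<^sup>2 * \<bar>q (x + k) h - q x h\<bar> \<le> s\<^sup>2 * (3044 * C * t * (norm h)\<^sup>2)"
    using ts(1,2) unfolding ts(4)
    by (simp add: q_homogeneous right_diff_distrib[symmetric] abs_mult power_mult_distrib
        eval_nat_numeral mult_ac)
  then have "\<bar>q (x + k) h - q x h\<bar> \<le> 3044 * C * t * (norm h)\<^sup>2"
    by (rule mult_left_le_imp_le) (use ts(2) in simp)
  then show ?thesis by (simp only: t_s_def)
qed

text \<open>
The polarization of \<open>q x\<close>.  Its bilinearity is not visible here; it is inherited from the
linearity of \<open>Du\<close> through \<open>hess_is_limit\<close> below.
\<close>

definition hess :: "'a \<Rightarrow> 'a \<Rightarrow> 'a \<Rightarrow> real" where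
  "hess x h k = (q x (h + k) - q x h - q x k) / 2"

lemma hess_sym: "hess x h k = hess x k h"
  by (simp add: hess_def add.commute)

lemma hess_scale: "0 \<le> s \<Longrightarrow> hess x (s *\<^sub>R h) (s *\<^sub>R k) = s\<^sup>2 * hess x h k"
  by (simp add: hess_def q_homogeneous right_diff_distrib flip: scaleR_add_right)

text \<open>
The value \<open>u (x + k + h)\<close> is expanded at \<open>x\<close> with increment \<open>h + k\<close>, and also at \<open>x + k\<close> with
increment \<open>h\<close>, where \<open>u (x + k)\<close> is in turn expanded at \<open>x\<close>.  In the difference of the two results
\<open>Du (x + k) h - Du x h\<close> remains from the first-order terms, and the second-order terms combine to
the polarization, because \<open>q (x + k) h\<close> may be replaced by \<open>q x h\<close>.
\<close>

lemma Du_increment: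
  assumes h: "norm h \<le> t" and k: "norm k \<le> t" and t: "norm x + 3 * t < \<rho>" "6 * t \<le> R"
  shows "\<bar>Du (x + k) h - Du x h - hess x h k\<bar> \<le> 1532 * (C * t ^ 3)"
proof -
  have t0: "0 \<le> t" using h norm_ge_zero order_trans by blast
  have x: "norm x < \<rho>" "norm (x + k) < \<rho>"
    using norm_triangle_ineq[of x k] k t t0 by linarith+
  have E: "\<bar>u (y + v) - u y - Du y v - q y v / 2\<bar> \<le> C * (c * t) ^ 3"
    if "norm y < \<rho>" "norm v \<le> c * t" "c \<le> 2" for y v c
  proof -
    have "c * t \<le> 2 * t" using that t0 by (intro mult_right_mono)
    then have "norm v \<le> R" using that t t0 by linarith
    then have "\<bar>u (y + v) - u y - Du y v - q y v / 2\<bar> \<le> C * norm v ^ 3"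
      by (rule expansion[OF that(1)])
    also have "\<dots> \<le> C * (c * t) ^ 3" using that C by (intro mult_left_mono power_mono) auto
    finally show ?thesis .
  qed
  have "norm (h + k) \<le> 2 * t" using norm_triangle_ineq[of h k] h k by linarith
  then have "\<bar>u (x + (h + k)) - u x - (Du x h + Du x k) - q x (h + k) / 2\<bar> \<le> 8 * (C * t ^ 3)"
    using E[OF x(1), of "h + k" 2] by (simp add: linear_Du x linear_add power_mult_distrib)
  moreover have "\<bar>u (x + k) - u x - Du x k - q x k / 2\<bar> \<le> C * t ^ 3"
    using E[OF x(1), of k 1] k by simp
  moreover have "\<bar>u (x + (h + k)) - u (x + k) - Du (x + k) h - q (x + k) h / 2\<bar> \<le> C * t ^ 3"
    using E[OF x(2), of h 1] h by (simp add: add_ac)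
  moreover note q_close[OF assms]
  ultimately show ?thesis unfolding hess_def abs_le_iff diff_divide_distrib by linarith
qed

lemma hess_is_limit:
  assumes x: "norm x < \<rho>"
  shows "((\<lambda>s. (Du (x + s *\<^sub>R k) h - Du x h) / s) \<longlongrightarrow> hess x h k) (at_right 0)"
proof -
  define m where "m = norm h + norm k + 1"
  have m: "0 < m" "norm h \<le> m" "norm k \<le> m" by (auto simp: m_def add_nonneg_pos)
  define \<delta> where "\<delta> = min ((\<rho> - norm x) / (4 * m)) (R / (6 * m))"
  have \<delta>: "0 < \<delta>" using m x R by (auto simp: \<delta>_def)
  have "\<forall>\<^sub>F s in at_right 0. 0 < s \<and> s < \<delta>"
    using \<delta> eventually_at_right_real by (simp add: greaterThanLessThan_iff[symmetric] del: greaterThanLessThan_iff)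
  then have "\<forall>\<^sub>F s in at_right 0. norm ((Du (x + s *\<^sub>R k) h - Du x h) / s - hess x h k) \<le> 1532 * C * m ^ 3 * s"
  proof eventually_elim
    case (elim s)
    have "s * (4 * m) \<le> \<rho> - norm x" "s * (6 * m) \<le> R"
      using elim m by (simp_all add: \<delta>_def pos_less_divide_eq less_imp_le)
    moreover have "0 < s * m" using elim m by simp
    ultimately have sm: "norm x + 3 * (s * m) < \<rho>" "6 * (s * m) \<le> R" by linarith+
    have "norm (s *\<^sub>R h) \<le> s * m" "norm (s *\<^sub>R k) \<le> s * m" using elim m by auto
    from Du_increment[OF this sm]
    have "\<bar>Du (x + s *\<^sub>R k) (s *\<^sub>R h) - Du x (s *\<^sub>R h) - s\<^sup>2 * hess x h k\<bar> \<le> 1532 * (C * (s * m) ^ 3)"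
      using elim by (simp add: hess_scale)
    moreover have "norm (x + s *\<^sub>R k) < \<rho>"
      using norm_triangle_ineq[of x "s *\<^sub>R k"] \<open>norm (s *\<^sub>R k) \<le> s * m\<close> sm \<open>0 < s * m\<close> by linarith
    ultimately have "\<bar>s * Du (x + s *\<^sub>R k) h - s * Du x h - s\<^sup>2 * hess x h k\<bar> \<le> 1532 * (C * (s * m) ^ 3)"
      using x by (simp add: linear_Du linear_cmul)
    also have "s * Du (x + s *\<^sub>R k) h - s * Du x h - s\<^sup>2 * hess x h k
        = s\<^sup>2 * ((Du (x + s *\<^sub>R k) h - Du x h) / s - hess x h k)"
      using elim by (simp add: field_simps power2_eq_square)
    also have "1532 * (C * (s * m) ^ 3) = s\<^sup>2 * (1532 * C * m ^ 3 * s)"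
      by (simp add: power_mult_distrib eval_nat_numeral)
    finally show ?case using elim by (simp add: abs_mult)
  qed
  moreover have "((\<lambda>s. 1532 * C * m ^ 3 * s) \<longlongrightarrow> 0) (at_right 0)"
    by (auto intro!: tendsto_eq_intros)
  ultimately have "((\<lambda>s. (Du (x + s *\<^sub>R k) h - Du x h) / s - hess x h k) \<longlongrightarrow> 0) (at_right 0)"
    by (rule Lim_null_comparison)
  then show ?thesis by (rule LIM_zero_cancel)
qed

lemma linear_hess:
  assumes x: "norm x < \<rho>"
  shows "linear (hess x h)"
proof -
  have ev: "\<forall>\<^sub>F s in at_right 0. linear (Du (x + s *\<^sub>R k))" for k
  proof -
    have "((\<lambda>s::real. norm (x + s *\<^sub>R k)) \<longlongrightarrow> norm (x + 0 *\<^sub>R k)) (at_right 0)"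
      by (intro tendsto_intros)
    from order_tendstoD(2)[OF this, of \<rho>] x have "\<forall>\<^sub>F s in at_right 0. norm (x + s *\<^sub>R k) < \<rho>" by simp
    then show ?thesis by eventually_elim (rule linear_Du)
  qed
  have lin: "linear (\<lambda>h. hess x h k)" for k
  proof (rule linearI)
    fix h h'
    have "((\<lambda>s. (Du (x + s *\<^sub>R k) (h + h') - Du x (h + h')) / s) \<longlongrightarrow> hess x h k + hess x h' k) (at_right 0)"
    proof (rule Lim_transform_eventually[OF tendsto_add[OF hess_is_limit[OF x, of k h] hess_is_limit[OF x, of k h']]])
      show "\<forall>\<^sub>F s in at_right 0. (Du (x + s *\<^sub>R k) h - Du x h) / s + (Du (x + s *\<^sub>R k) h' - Du x h') / s
          = (Du (x + s *\<^sub>R k) (h + h') - Du x (h + h')) / s"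
        using ev[of k] by eventually_elim (simp add: linear_add linear_Du x add_divide_distrib diff_divide_distrib)
    qed
    from tendsto_unique[OF _ hess_is_limit[OF x, of k "h + h'"] this]
    show "hess x (h + h') k = hess x h k + hess x h' k" by simp
  next
    fix c h
    have "((\<lambda>s. (Du (x + s *\<^sub>R k) (c *\<^sub>R h) - Du x (c *\<^sub>R h)) / s) \<longlongrightarrow> c * hess x h k) (at_right 0)"
    proof (rule Lim_transform_eventually[OF tendsto_mult_left[OF hess_is_limit[OF x, of k h]]])
      show "\<forall>\<^sub>F s in at_right 0. c * ((Du (x + s *\<^sub>R k) h - Du x h) / s)
          = (Du (x + s *\<^sub>R k) (c *\<^sub>R h) - Du x (c *\<^sub>R h)) / s"
        using ev[of k] by eventually_elim (simp add: linear_cmul linear_Du x right_diff_distrib)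
    qed
    from tendsto_unique[OF _ hess_is_limit[OF x, of k "c *\<^sub>R h"] this]
    show "hess x (c *\<^sub>R h) k = c *\<^sub>R hess x h k" by simp
  qed
  have "(\<lambda>k. hess x k h) = hess x h"
    by (rule ext) (rule hess_sym)
  with lin[of h] show ?thesis by simp
qed

text \<open>
\<open>Du_increment\<close> controls the error by the larger of \<open>|h|\<close> and \<open>|k|\<close>.  As both sides are linear in
\<open>h\<close>, the fixed \<open>h\<close> may be rescaled to the length of \<open>k\<close>, which makes the error quadratic in \<open>k\<close>.
\<close>

lemma has_derivative_Du:
  assumes x: "norm x < \<rho>"
  shows "((\<lambda>y. Du y h) has_derivative hess x h) (at x)"
proof (rule has_derivativeI_sandwich)
  define \<delta> where "\<delta> = min ((\<rho> - norm x) / 4) (R / 6)"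
  show "0 < \<delta>" using x R by (simp add: \<delta>_def)
  show "bounded_linear (hess x h)"
    using linear_hess[OF x] by (simp add: linear_conv_bounded_linear)
  show "((\<lambda>y. 1532 * C * norm h * norm (y - x)) \<longlongrightarrow> 0) (at x)"
    by (auto intro!: tendsto_eq_intros)
  fix y assume y: "y \<noteq> x" "dist y x < \<delta>"
  define k t where "k = y - x" "t = norm (y - x)"
  have t: "0 < t" "norm x + 3 * t < \<rho>" "6 * t \<le> R"
  proof -
    show "0 < t" using y by (simp add: k_t_def)
    have "4 * t < \<rho> - norm x" "6 * t < R"
      using y(2) by (auto simp: k_t_def \<delta>_def dist_norm)
    with \<open>0 < t\<close> show "norm x + 3 * t < \<rho>" "6 * t \<le> R" by linarith+
  qed
  have y\<rho>: "norm y < \<rho>"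
  proof -
    have "norm y \<le> norm x + t" using norm_triangle_ineq[of x "y - x"] by (simp add: k_t_def)
    then show ?thesis using t by linarith
  qed
  show "norm (Du y h - Du x h - hess x h (y - x)) / norm (y - x) \<le> 1532 * C * norm h * norm (y - x)"
  proof (cases "h = 0")
    case True
    have "Du y 0 = 0" "Du x 0 = 0" using x y\<rho> by (auto simp: linear_Du linear_0)
    moreover have "hess x 0 (y - x) = 0" using q_homogeneous[of 0 x 0] by (simp add: hess_def)
    ultimately show ?thesis using True by simp
  next
    case False
    define s where "s = t / norm h"
    have s: "0 < s" "norm (s *\<^sub>R h) = t" "t = s * norm h" using False t by (auto simp: s_def)
    have "hess x (s *\<^sub>R h) k = s * hess x h k"
      using linear_cmul[OF linear_hess[OF x, of k], of s h] by (simp add: hess_sym[of x k])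
    moreover have "\<bar>Du (x + k) (s *\<^sub>R h) - Du x (s *\<^sub>R h) - hess x (s *\<^sub>R h) k\<bar> \<le> 1532 * (C * t ^ 3)"
      by (rule Du_increment) (use s t in \<open>auto simp: k_t_def\<close>)
    ultimately have "\<bar>s * (Du y h - Du x h - hess x h k)\<bar> \<le> 1532 * (C * t ^ 3)"
      using x y\<rho> by (simp add: linear_Du linear_cmul right_diff_distrib k_t_def)
    also have "\<dots> = s * (1532 * C * norm h * t * t)"
      using s(3) by (simp add: power3_eq_cube)
    finally have "\<bar>Du y h - Du x h - hess x h k\<bar> \<le> 1532 * C * norm h * t * t"
      using s(1) by (simp add: abs_mult)
    then show ?thesis using t(1) by (simp add: k_t_def field_simps)
  qed
qed

text \<open>
For close points this is \<open>q_lipschitz\<close>; for distant points it suffices that \<open>hess\<close> is bounded,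
which \<open>Du_increment\<close> at a fixed scale \<open>\<delta>\<close> derives from the boundedness of \<open>Du\<close>.
\<close>

lemma hess_lipschitz:
  assumes r: "r < \<rho>" and bdd: "bounded ((\<lambda>y. Du y h) ` ball 0 \<rho>)"
  shows "\<exists>L. L-lipschitz_on (ball 0 r) (\<lambda>x. hess x h k)"
proof -
  define m \<delta> where "m = norm h + norm k + 1" "\<delta> = min ((\<rho> - r) / 4) (R / 6)"
  have m: "0 < m" "norm h \<le> m" "norm k \<le> m" "norm (h + k) \<le> m"
    using norm_triangle_ineq[of h k] by (auto simp: m_\<delta>_def add_nonneg_pos)
  have \<delta>: "0 < \<delta>" using r R by (simp add: m_\<delta>_def)
  obtain A where "\<forall>y\<in>ball 0 \<rho>. \<bar>Du y h\<bar> \<le> A"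
    using bdd by (auto simp: bounded_iff)
  then have A: "\<bar>Du y h\<bar> \<le> A" if "norm y < \<rho>" for y
    using that by simp
  define L1 s L2 where "L1 = 4566 * C * m\<^sup>2" "s = \<delta> / m" "L2 = (s * A + s * A + 1532 * (C * \<delta> ^ 3)) / s\<^sup>2"
  note Ls = this
  have s: "0 < s" "s * m = \<delta>" using m \<delta> by (auto simp: Ls)
  have near: "\<bar>hess y h k - hess x h k\<bar> \<le> L1 * dist y x"
    if "norm x < r" "dist y x \<le> \<delta>" for x y
  proof -
    have sm: "norm x + 3 * norm (y - x) < \<rho>" "6 * norm (y - x) \<le> R"
    proof -
      have "4 * norm (y - x) \<le> \<rho> - r" "6 * norm (y - x) \<le> R"
        using that(2) by (auto simp: m_\<delta>_def dist_norm)
      then show "norm x + 3 * norm (y - x) < \<rho>" "6 * norm (y - x) \<le> R"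
        using that(1) r norm_ge_zero[of "y - x"] by linarith+
    qed
    have Q: "\<bar>q y v - q x v\<bar> \<le> 3044 * C * dist y x * m\<^sup>2" if "norm v \<le> m" for v
    proof -
      have "\<bar>q y v - q x v\<bar> \<le> 3044 * C * norm (y - x) * (norm v)\<^sup>2"
        using q_lipschitz[OF sm, of v] by simp
      also have "\<dots> \<le> 3044 * C * norm (y - x) * m\<^sup>2"
        using C that by (intro mult_left_mono power_mono) auto
      finally show ?thesis by (simp add: dist_norm)
    qed
    define E where "E = 3044 * C * dist y x * m\<^sup>2"
    have "\<bar>hess y h k - hess x h k\<bar> \<le> 3 / 2 * E"
      using Q[OF m(2)] Q[OF m(3)] Q[OF m(4)]
      unfolding hess_def abs_le_iff E_def[symmetric] diff_divide_distrib by linarith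
    then show ?thesis by (simp add: Ls E_def mult_ac)
  qed
  have bound: "\<bar>hess x h k\<bar> \<le> L2" if "norm x < r" for x
  proof -
    have sm: "norm x + 3 * \<delta> < \<rho>" "6 * \<delta> \<le> R"
    proof -
      have "4 * \<delta> \<le> \<rho> - r" "6 * \<delta> \<le> R" by (auto simp: m_\<delta>_def min_def)
      then show "norm x + 3 * \<delta> < \<rho>" "6 * \<delta> \<le> R" using that r by linarith+
    qed
    have nh: "norm (s *\<^sub>R h) \<le> \<delta>" "norm (s *\<^sub>R k) \<le> \<delta>"
      using m(2,3) s(1) unfolding s(2)[symmetric] by auto
    have x: "norm x < \<rho>" "norm (x + s *\<^sub>R k) < \<rho>"
      using norm_triangle_ineq[of x "s *\<^sub>R k"] nh sm \<delta> by linarith+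
    have "\<bar>s * Du y h\<bar> \<le> s * A" if "norm y < \<rho>" for y
      using A[OF that] s(1) by (simp add: abs_mult)
    note this[OF x(1)] this[OF x(2)]
    moreover have "\<bar>s * Du (x + s *\<^sub>R k) h - s * Du x h - s\<^sup>2 * hess x h k\<bar> \<le> 1532 * (C * \<delta> ^ 3)"
      using Du_increment[OF nh sm] s(1) x by (simp add: hess_scale linear_Du linear_cmul)
    ultimately have "\<bar>s\<^sup>2 * hess x h k\<bar> \<le> s * A + s * A + 1532 * (C * \<delta> ^ 3)"
      by linarith
    then show ?thesis using s(1) by (simp add: Ls(3) abs_mult pos_le_divide_eq mult.commute)
  qed
  have L: "0 \<le> L1" using C by (simp add: Ls)
  have "(L1 + 2 * \<bar>L2\<bar> / \<delta>)-lipschitz_on (ball 0 r) (\<lambda>x. hess x h k)"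
  proof (rule lipschitz_onI)
    show "0 \<le> L1 + 2 * \<bar>L2\<bar> / \<delta>" using L \<delta> by simp
    fix y x :: 'a assume xy: "y \<in> ball 0 r" "x \<in> ball 0 r"
    show "dist (hess y h k) (hess x h k) \<le> (L1 + 2 * \<bar>L2\<bar> / \<delta>) * dist y x"
    proof (cases "dist y x \<le> \<delta>")
      case True
      have "0 \<le> 2 * \<bar>L2\<bar> / \<delta> * dist y x" using \<delta> by simp
      then show ?thesis
        using near[OF _ True] xy by (simp add: dist_real_def distrib_right)
    next
      case False
      have "\<bar>hess y h k - hess x h k\<bar> \<le> 2 * \<bar>L2\<bar>"
        using bound[of x] bound[of y] xy by simp
      also have "\<dots> = 2 * \<bar>L2\<bar> / \<delta> * \<delta>" using \<delta> by simp
      also have "\<dots> \<le> 2 * \<bar>L2\<bar> / \<delta> * dist y x" using False \<delta> by (intro mult_left_mono) auto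
      finally show ?thesis using L by (simp add: dist_real_def distrib_right add_increasing)
    qed
  qed
  then show ?thesis by blast
qed

end

section \<open>Iterated derivatives along lines\<close>

lemma frechet_derivative_eq_sum:
  assumes "f differentiable (at p)"
  shows "frechet_derivative f (at p) v = (\<Sum>i\<in>UNIV. v $ i *\<^sub>R pderiv_at i f p)"
proof -
  interpret linear "frechet_derivative f (at p)"
    using assms by (rule linear_frechet_derivative)
  have "v = (\<Sum>i\<in>UNIV. v $ i *\<^sub>R axis i 1)"
    using basis_expansion[of v] by (simp add: scalar_mult_eq_scaleR)
  then have "frechet_derivative f (at p) v = frechet_derivative f (at p) (\<Sum>i\<in>UNIV. v $ i *\<^sub>R axis i 1)"
    by simp
  then show ?thesis by (simp add: sum scaleR pderiv_at_def)
qed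

lemma has_vector_derivative_along_line:
  assumes "(f has_derivative f') (at (x + t *\<^sub>R v))"
  shows "((\<lambda>t. f (x + t *\<^sub>R v)) has_vector_derivative f' v) (at t)"
proof -
  have "((\<lambda>t. x + t *\<^sub>R v) has_derivative (\<lambda>h. h *\<^sub>R v)) (at t)"
    by (auto intro!: derivative_eq_intros)
  from has_derivative_compose[OF this assms] show ?thesis
    using has_derivative_bounded_linear[OF assms]
    by (simp add: has_vector_derivative_def linear_cmul bounded_linear.linear)
qed

text \<open>
The \<open>k\<close>-th derivative of \<open>f\<close> at \<open>p\<close> in the direction \<open>v\<close>, expressed by iterated partial
derivatives so that the definition of \<open>Ck_on\<close> applies to it by induction on \<open>k\<close>.
\<close>

primrec dir_deriv :: "nat \<Rightarrow> (real^'n \<Rightarrow> 'b::real_normed_vector) \<Rightarrow> real^'n \<Rightarrow> real^'n \<Rightarrow> 'b" where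
  "dir_deriv 0 f v p = f p"
| "dir_deriv (Suc k) f v p = (\<Sum>i\<in>UNIV. v $ i *\<^sub>R dir_deriv k (pderiv_at i f) v p)"

lemma Ck_on_Suc_imp: "Ck_on (Suc k) f S \<Longrightarrow> Ck_on k f S"
proof (induction k arbitrary: f)
  case 0
  then show ?case
    by (auto intro!: continuous_at_imp_continuous_on differentiable_imp_continuous_within)
next
  case (Suc k)
  then show ?case unfolding Ck_on.simps(2)[of "Suc k"] Ck_on.simps(2)[of k] by blast
qed

lemma Ck_on_mono: "j \<le> k \<Longrightarrow> Ck_on k f S \<Longrightarrow> Ck_on j f S"
  by (induction k rule: dec_induct) (auto intro: Ck_on_Suc_imp simp del: Ck_on.simps)

lemma dir_deriv_along_line:
  assumes "Ck_on (Suc k) f S" "x + t *\<^sub>R v \<in> S"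
  shows "((\<lambda>t. dir_deriv k f v (x + t *\<^sub>R v)) has_vector_derivative
    dir_deriv (Suc k) f v (x + t *\<^sub>R v)) (at t)"
  using assms
proof (induction k arbitrary: f)
  case 0
  then have d: "f differentiable (at (x + t *\<^sub>R v))" by simp
  from has_vector_derivative_along_line[OF this[unfolded frechet_derivative_works]]
  show ?case by (simp add: frechet_derivative_eq_sum[OF d])
next
  case (Suc k)
  have "Ck_on (Suc k) (pderiv_at i f) S" for i
    using Suc.prems(1) unfolding Ck_on.simps(2)[of "Suc k"] by blast
  from Suc.IH[OF this Suc.prems(2)]
  have "((\<lambda>t. \<Sum>i\<in>UNIV. v $ i *\<^sub>R dir_deriv k (pderiv_at i f) v (x + t *\<^sub>R v)) has_vector_derivative
     (\<Sum>i\<in>UNIV. v $ i *\<^sub>R dir_deriv (Suc k) (pderiv_at i f) v (x + t *\<^sub>R v))) (at t)"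
    by (intro has_vector_derivative_sum has_vector_derivative_scaleR[OF DERIV_const, simplified])
  then show ?case by simp
qed

lemma dir_deriv_bounded:
  assumes "Ck_on k f S" "compact K" "K \<subseteq> S"
  shows "\<exists>M. \<forall>p\<in>K. \<forall>v. norm v \<le> 1 \<longrightarrow> norm (dir_deriv k f v p) \<le> M"
  using assms(1)
proof (induction k arbitrary: f)
  case 0
  then have "bounded (f ` K)"
    using assms by (auto intro!: compact_imp_bounded compact_continuous_image intro: continuous_on_subset)
  then show ?case by (auto simp: bounded_iff)
next
  case (Suc k)
  have "\<forall>i. \<exists>M. \<forall>p\<in>K. \<forall>v. norm v \<le> 1 \<longrightarrow> norm (dir_deriv k (pderiv_at i f) v p) \<le> M"
    using Suc by auto
  then obtain M where M: "\<And>i p v. p \<in> K \<Longrightarrow> norm v \<le> 1 \<Longrightarrow> norm (dir_deriv k (pderiv_at i f) v p) \<le> M i"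
    by metis
  have "norm (dir_deriv (Suc k) f v p) \<le> (\<Sum>i\<in>UNIV. M i)" if "p \<in> K" "norm v \<le> 1" for p v
    unfolding dir_deriv.simps
  proof (rule sum_norm_le)
    fix i
    have "\<bar>v $ i\<bar> \<le> 1" using component_le_norm_cart[of v i] that by simp
    then have "\<bar>v $ i\<bar> * norm (dir_deriv k (pderiv_at i f) v p) \<le> 1 * M i"
      using M[OF that, of i] by (intro mult_mono) auto
    then show "norm (v $ i *\<^sub>R dir_deriv k (pderiv_at i f) v p) \<le> M i" by simp
  qed
  then show ?case by blast
qed

lemma bounded_linear_quadratic_form:
  fixes v :: "real^'n"
  shows "bounded_linear (\<lambda>A::real^'n^'n. v \<bullet> (A *v v))"
  unfolding linear_conv_bounded_linear[symmetric]
  by (rule linearI)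
    (simp_all add: matrix_vector_mult_add_rdistrib inner_add_right flip: scaleR_matrix_vector_assoc)

lemma quadratic_form_bound:
  fixes A :: "real^'n^'n"
  assumes "norm v \<le> 1"
  shows "\<bar>v \<bullet> (A *v v)\<bar> \<le> real CARD('n) * real CARD('n) * norm A"
proof -
  have v: "\<bar>v $ i\<bar> \<le> 1" for i using component_le_norm_cart[of v i] assms by simp
  have "\<bar>v \<bullet> (A *v v)\<bar> = \<bar>\<Sum>i\<in>UNIV. \<Sum>j\<in>UNIV. v $ i * (A $ i $ j * v $ j)\<bar>"
    by (simp add: inner_vec_def matrix_vector_mult_def sum_distrib_left)
  also have "\<dots> \<le> (\<Sum>i\<in>(UNIV::'n set). \<Sum>j\<in>(UNIV::'n set). norm A)"
  proof (rule order_trans[OF sum_abs], rule sum_mono, rule order_trans[OF sum_abs], rule sum_mono)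
    fix i j
    have "\<bar>A $ i $ j\<bar> \<le> norm A"
      using component_le_norm_cart[of "A $ i" j] Finite_Cartesian_Product.norm_nth_le[of A i] by linarith
    then have "\<bar>v $ i\<bar> * (\<bar>A $ i $ j\<bar> * \<bar>v $ j\<bar>) \<le> 1 * (norm A * 1)"
      using v by (intro mult_mono) auto
    then show "\<bar>v $ i * (A $ i $ j * v $ j)\<bar> \<le> norm A" by (simp add: abs_mult)
  qed
  also have "\<dots> = real CARD('n) * real CARD('n) * norm A" by simp
  finally show ?thesis .
qed

text \<open>
The tangents at both points lie below the graph of the restriction of \<open>u\<close> to the line; adding
the two inequalities gives the monotonicity.
\<close>

lemma convex_on_derivative_mono:
  fixes u :: "'a::real_normed_vector \<Rightarrow> real"
  assumes cvx: "convex_on S u" and S: "open S" "convex S"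
    and D: "\<And>p. p \<in> S \<Longrightarrow> (u has_derivative Du p) (at p)"
    and st: "s \<le> t" "x + s *\<^sub>R v \<in> S" "x + t *\<^sub>R v \<in> S"
  shows "Du (x + s *\<^sub>R v) v \<le> Du (x + t *\<^sub>R v) v"
proof (cases "s = t")
  case False
  define T where "T = (\<lambda>t. x + t *\<^sub>R v) -` S"
  have aff: "x + ((1 - l) * a + l * b) *\<^sub>R v = (1 - l) *\<^sub>R (x + a *\<^sub>R v) + l *\<^sub>R (x + b *\<^sub>R v)" for a b l
    by (simp add: algebra_simps)
  have T: "open T" unfolding T_def
    using S(1) by (intro open_vimage) (auto intro!: continuous_intros)
  have T': "convex T"
    using S(2) by (auto simp: convex_alt T_def aff)
  have "convex_on T (\<lambda>t. u (x + t *\<^sub>R v))"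
  proof (rule convex_onI[OF _ T'])
    fix l a b :: real assume "0 < l" "l < 1" "a \<in> T" "b \<in> T"
    then show "u (x + ((1 - l) *\<^sub>R a + l *\<^sub>R b) *\<^sub>R v) \<le> (1 - l) * u (x + a *\<^sub>R v) + l * u (x + b *\<^sub>R v)"
      using convex_onD[OF cvx, of l "x + a *\<^sub>R v" "x + b *\<^sub>R v"] by (simp add: aff T_def)
  qed
  have tangent: "Du (x + a *\<^sub>R v) v * (b - a) \<le> u (x + b *\<^sub>R v) - u (x + a *\<^sub>R v)"
    if "a \<in> T" "b \<in> T" for a b
  proof (rule convex_on_imp_above_tangent[OF \<open>convex_on T _\<close>])
    show "connected T" using T' by (rule convex_connected)
    show "a \<in> interior T" using T that by (simp add: interior_open)
    have "((\<lambda>t. u (x + t *\<^sub>R v)) has_vector_derivative Du (x + a *\<^sub>R v) v) (at a)"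
      by (rule has_vector_derivative_along_line[OF D]) (use that in \<open>auto simp: T_def\<close>)
    then show "((\<lambda>t. u (x + t *\<^sub>R v)) has_real_derivative Du (x + a *\<^sub>R v) v) (at a within T)"
      by (simp add: has_real_derivative_iff_has_vector_derivative has_vector_derivative_at_within)
  qed (use that in auto)
  have sT: "s \<in> T" "t \<in> T" using st by (auto simp: T_def)
  have "0 \<le> (Du (x + t *\<^sub>R v) v - Du (x + s *\<^sub>R v) v) * (t - s)"
    using tangent[OF sT] tangent[OF sT(2,1)] by (simp add: algebra_simps)
  then show ?thesis using st(1) False by (simp add: zero_le_mult_iff)
qed simp

section \<open>Graphs with a metric of class \<open>C\<^sup>4\<close>\<close>

text \<open>
The restriction to a line is an instance of \<open>smooth_square\<close>.  Its constants \<open>M'\<close> and \<open>R\<close> come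
from compactness of a ball between the radii \<open>\<rho>\<close> and \<open>r\<close>, so they are the same for all lines.
\<close>

lemma uniform_expansion_along_lines:
  fixes u :: "real^'n \<Rightarrow> real" and h :: "real^'n \<Rightarrow> real^'n^'n"
  assumes h: "Ck_on 4 h (ball 0 r)"
    and cvx: "convex_on (ball 0 r) u"
    and D: "\<And>p. p \<in> ball 0 r \<Longrightarrow> (u has_derivative Du p) (at p)"
    and cont: "\<And>v. continuous_on (ball 0 r) (\<lambda>p. Du p v)"
    and square: "\<And>p v. p \<in> ball 0 r \<Longrightarrow> (Du p v)\<^sup>2 = v \<bullet> (h p *v v) - v \<bullet> v"
    and \<rho>: "\<rho> < r"
  obtains C R where "0 \<le> C" "0 < R"
    "\<And>x v. norm x < \<rho> \<Longrightarrow> norm v = 1 \<Longrightarrow> \<exists>d. \<forall>t. 0 \<le> t \<and> t \<le> R \<longrightarrow>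
       \<bar>u (x + t *\<^sub>R v) - u x - t * Du x v - d * t\<^sup>2 / 2\<bar> \<le> C * t ^ 3"
proof -
  define R K where "R = min 1 ((r - \<rho>) / 2)" "K = cball (0::real^'n) ((\<rho> + r) / 2)"
  have R: "0 < R" "R \<le> 1" "R \<le> (r - \<rho>) / 2" using \<rho> by (auto simp: R_K_def min_def)
  have K: "compact K" "K \<subseteq> ball 0 r" using \<rho> by (auto simp: R_K_def)
  have inK: "x + t *\<^sub>R v \<in> K" if "norm x < \<rho>" "norm v = 1" "\<bar>t\<bar> \<le> R" for x t v
  proof -
    have "norm (x + t *\<^sub>R v) \<le> norm x + \<bar>t\<bar>"
      using norm_triangle_ineq[of x "t *\<^sub>R v"] that by simp
    also have "\<dots> \<le> (\<rho> + r) / 2" using that R by (simp add: field_simps)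
    finally show ?thesis by (simp add: R_K_def)
  qed
  have "\<forall>k\<in>{..4}. \<exists>M. \<forall>p\<in>K. \<forall>v. norm v \<le> 1 \<longrightarrow> norm (dir_deriv k h v p) \<le> M"
    using dir_deriv_bounded[OF Ck_on_mono[OF _ h] K] by simp
  then obtain M where M: "\<And>k p v. k \<le> 4 \<Longrightarrow> p \<in> K \<Longrightarrow> norm v \<le> 1 \<Longrightarrow> norm (dir_deriv k h v p) \<le> M k"
    unfolding Ball_def by (metis atMost_iff)
  define N M' where "N = real CARD('n) * real CARD('n)" "M' = 1 + N * (\<Sum>k\<le>4. \<bar>M k\<bar>)"
  have N: "0 \<le> N" by (simp add: N_M'_def)
  have M': "1 \<le> M'" using N by (simp add: N_M'_def sum_nonneg)
  obtain C where C: "\<And>F a x. smooth_square F a M' R x \<Longrightarrow>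
      \<exists>d. \<forall>t. \<bar>t\<bar> \<le> R / 2 \<longrightarrow> \<bar>a (x + t) - a x - d * t\<bar> \<le> C * t\<^sup>2"
    using monotone_root_expansion[OF M' R(1,2)] by metis
  show ?thesis
  proof (rule that[of "\<bar>C\<bar>" "R / 2"])
    fix x v :: "real^'n" assume xv: "norm x < \<rho>" "norm v = 1"
    have inS: "x + t *\<^sub>R v \<in> ball 0 r" if "\<bar>t\<bar> \<le> R" for t
      using inK[OF xv that] K by blast
    have vv: "v \<bullet> v = 1" using xv by (simp add: dot_square_norm)
    define F a where
      "F = (\<lambda>k t. v \<bullet> (dir_deriv k h v (x + t *\<^sub>R v) *v v) - (if k = 0 then 1 else 0))"
      "a = (\<lambda>t. Du (x + t *\<^sub>R v) v)"
    have "smooth_square F a M' R 0"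
    proof
      show "1 \<le> M'" "0 < R" "R \<le> 1" using M' R by auto
      show "continuous_on {0 - R..0 + R} a"
        unfolding F_a_def
        by (rule continuous_on_compose2[OF cont[of v]])
           (auto intro!: continuous_intros inS[unfolded mem_ball_0] simp: abs_le_iff)
      show "F 0 t = (a t)\<^sup>2" if "\<bar>t - 0\<bar> \<le> R" for t
        using square[OF inS[of t], of v] that by (simp add: F_a_def vv)
      show "a s \<le> a t" if "\<bar>s - 0\<bar> \<le> R" "\<bar>t - 0\<bar> \<le> R" "s \<le> t" for s t
        unfolding F_a_def
        by (rule convex_on_derivative_mono[OF cvx open_ball convex_ball D that(3)])
           (use inS that in simp_all)
      fix k :: nat and t :: real assume t: "\<bar>t - 0\<bar> \<le> R"
      then have tR: "\<bar>t\<bar> \<le> R" by simp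
      show "\<bar>F k t\<bar> \<le> M'" if k: "k \<le> 4"
      proof -
        have "\<bar>v \<bullet> (dir_deriv k h v (x + t *\<^sub>R v) *v v)\<bar> \<le> N * norm (dir_deriv k h v (x + t *\<^sub>R v))"
          unfolding N_M'_def using xv by (intro quadratic_form_bound) simp
        also have "norm (dir_deriv k h v (x + t *\<^sub>R v)) \<le> M k"
          by (rule M[OF k inK[OF xv tR]]) (simp add: xv)
        also have "M k \<le> (\<Sum>k\<le>4. \<bar>M k\<bar>)"
          using member_le_sum[of k "{..4}" "\<lambda>k. \<bar>M k\<bar>"] k by simp
        finally have "\<bar>v \<bullet> (dir_deriv k h v (x + t *\<^sub>R v) *v v)\<bar> \<le> N * (\<Sum>k\<le>4. \<bar>M k\<bar>)"
          using N by (simp add: mult_left_mono)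
        moreover have "\<bar>F k t\<bar> \<le> \<bar>v \<bullet> (dir_deriv k h v (x + t *\<^sub>R v) *v v)\<bar> + 1"
          by (auto simp: F_a_def)
        ultimately show ?thesis unfolding N_M'_def(2) by linarith
      qed
      show "(F k has_real_derivative F (Suc k) t) (at t)" if k: "k < 4"
      proof -
        have "((\<lambda>t. dir_deriv k h v (x + t *\<^sub>R v)) has_vector_derivative
            dir_deriv (Suc k) h v (x + t *\<^sub>R v)) (at t)"
          using Ck_on_mono[OF _ h, of "Suc k"] k inS[OF tR] by (intro dir_deriv_along_line) auto
        from bounded_linear.has_vector_derivative[OF bounded_linear_quadratic_form this]
        have "((\<lambda>t. v \<bullet> (dir_deriv k h v (x + t *\<^sub>R v) *v v)) has_real_derivative
            v \<bullet> (dir_deriv (Suc k) h v (x + t *\<^sub>R v) *v v)) (at t)"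
          unfolding has_real_derivative_iff_has_vector_derivative .
        from DERIV_diff[OF this DERIV_const[of "if k = 0 then 1 else 0"]]
        show ?thesis unfolding F_a_def by simp
      qed
    qed
    from C[OF this] obtain d where d: "\<And>t. \<bar>t\<bar> \<le> R / 2 \<Longrightarrow> \<bar>a t - a 0 - d * t\<bar> \<le> C * t\<^sup>2"
      by auto
    have "\<bar>u (x + t *\<^sub>R v) - u x - t * Du x v - d * t\<^sup>2 / 2\<bar> \<le> \<bar>C\<bar> * t ^ 3" if t: "0 < t" "t \<le> R / 2" for t
    proof -
      have "\<exists>s>0. s < t \<and> (u (x + t *\<^sub>R v) - t * a 0 - d * t\<^sup>2 / 2) - (u (x + 0 *\<^sub>R v) - 0 * a 0 - d * 0\<^sup>2 / 2)
          = (t - 0) * (a s - a 0 - d * s)"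
      proof (rule MVT2[OF t(1)])
        fix s assume s: "0 \<le> s" "s \<le> t"
        have "((\<lambda>s. u (x + s *\<^sub>R v)) has_real_derivative a s) (at s)"
          unfolding has_real_derivative_iff_has_vector_derivative F_a_def
          by (rule has_vector_derivative_along_line[OF D]) (rule inS, use s t R in simp)
        then show "((\<lambda>s. u (x + s *\<^sub>R v) - s * a 0 - d * s\<^sup>2 / 2) has_real_derivative (a s - a 0 - d * s)) (at s)"
          by (auto intro!: derivative_eq_intros)
      qed
      then obtain s where s: "0 < s" "s < t" and eq: "u (x + t *\<^sub>R v) - u x - t * a 0 - d * t\<^sup>2 / 2
          = t * (a s - a 0 - d * s)"
        by (auto simp: algebra_simps)
      have "\<bar>a s - a 0 - d * s\<bar> \<le> C * s\<^sup>2" by (rule d) (use s t in simp)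
      also have "\<dots> \<le> \<bar>C\<bar> * t\<^sup>2" using s by (intro mult_mono power_mono) auto
      finally have "t * \<bar>a s - a 0 - d * s\<bar> \<le> t * (\<bar>C\<bar> * t\<^sup>2)"
        using t by (intro mult_left_mono) auto
      moreover have "u (x + t *\<^sub>R v) - u x - t * Du x v - d * t\<^sup>2 / 2 = t * (a s - a 0 - d * s)"
        using eq by (simp add: F_a_def)
      ultimately show ?thesis
        using t(1) by (simp add: abs_mult power2_eq_square power3_eq_cube mult_ac)
    qed
    then show "\<exists>d. \<forall>t. 0 \<le> t \<and> t \<le> R / 2 \<longrightarrow>
        \<bar>u (x + t *\<^sub>R v) - u x - t * Du x v - d * t\<^sup>2 / 2\<bar> \<le> \<bar>C\<bar> * t ^ 3"
      by (intro exI[of _ d] allI impI) (case_tac "t = 0", auto)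
  qed (use R in auto)
qed

text \<open>
The function \<open>q\<close> is defined by choosing the coefficient \<open>d\<close> for every unit vector and
extending homogeneously.
\<close>

lemma directional_taylorI:
  fixes u :: "'a::euclidean_space \<Rightarrow> real"
  assumes C: "0 \<le> C" and R: "0 < R"
    and lin: "\<And>x. norm x < \<rho> \<Longrightarrow> linear (Du x)"
    and ex: "\<And>x v. norm x < \<rho> \<Longrightarrow> norm v = 1 \<Longrightarrow> \<exists>d. \<forall>t. 0 \<le> t \<and> t \<le> R \<longrightarrow>
       \<bar>u (x + t *\<^sub>R v) - u x - t * Du x v - d * t\<^sup>2 / 2\<bar> \<le> C * t ^ 3"
  obtains q where "directional_taylor u Du q C R \<rho>"
proof -
  obtain e where e: "\<And>x v t. norm x < \<rho> \<Longrightarrow> norm v = 1 \<Longrightarrow> 0 \<le> t \<Longrightarrow> t \<le> R \<Longrightarrow>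
       \<bar>u (x + t *\<^sub>R v) - u x - t * Du x v - e x v * t\<^sup>2 / 2\<bar> \<le> C * t ^ 3"
    using ex by metis
  have "directional_taylor u Du (\<lambda>x h. e x (sgn h) * (norm h)\<^sup>2) C R \<rho>"
  proof (rule directional_taylor.intro)
    fix x h :: 'a and s :: real assume "0 \<le> s"
    then show "e x (sgn (s *\<^sub>R h)) * (norm (s *\<^sub>R h))\<^sup>2 = s\<^sup>2 * (e x (sgn h) * (norm h)\<^sup>2)"
      by (cases "s = 0") (auto simp: sgn_scaleR power_mult_distrib)
  next
    fix x h :: 'a assume x: "norm x < \<rho>" and h: "norm h \<le> R"
    show "\<bar>u (x + h) - u x - Du x h - e x (sgn h) * (norm h)\<^sup>2 / 2\<bar> \<le> C * norm h ^ 3"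
    proof (cases "h = 0")
      case True
      then show ?thesis using lin[OF x] by (simp add: linear_0)
    next
      case False
      then have n: "norm (sgn h) = 1" "norm h *\<^sub>R sgn h = h" by (auto simp: norm_sgn sgn_div_norm)
      then have "Du x h = norm h * Du x (sgn h)" using linear_cmul[OF lin[OF x], of "norm h" "sgn h"] by simp
      then show ?thesis using e[OF x n(1), of "norm h"] h n(2) by simp
    qed
  qed (use C R lin in auto)
  then show ?thesis by (rule that)
qed

theorem theorem1p4:
  fixes r :: real
    and g :: "real^2 \<Rightarrow> real^2^2"
    and u :: "real^2 \<Rightarrow> real"
    and X :: "real^2 \<Rightarrow> real^3"
  assumes "r > 0"
    and "Riemannian_metric_on 4 (ball 0 r) g"
    and "\<forall>p\<in>ball 0 r. gauss_curvature g p \<ge> 0"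
    and "Ck1_embedding_on 1 (ball 0 r) X"
    and "isometric_on (ball 0 r) g X"
    and "\<forall>p\<in>ball 0 r. X p = vector [p $ 1, p $ 2, u p]"
    and "u 0 = 0"
    and "pderiv_at 1 u 0 = 0"
    and "pderiv_at 2 u 0 = 0"
    and "convex_on (ball 0 r) u"
  shows "\<forall>r'. 0 < r' \<and> r' < r \<longrightarrow> Ck1_on 2 X (ball 0 r')"
proof (intro allI impI)
  fix r' assume r': "0 < r' \<and> r' < r"
  \<comment> \<open>\<open>X = P + u e\<close> with a linear isometry \<open>P\<close> onto the horizontal plane and the vertical unit vector \<open>e\<close>\<close>
  define B where "B = ball (0::real^2) r"
  define Du where "Du p = frechet_derivative u (at p)" for p
  define P :: "real^2 \<Rightarrow> real^3" where "P v = v $ 1 *\<^sub>R axis 1 1 + v $ 2 *\<^sub>R axis 2 1" for v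
  define e :: "real^3" where "e = axis 3 1"
  have P: "bounded_linear P"
    unfolding P_def linear_conv_bounded_linear[symmetric]
    by (rule linearI) (simp_all add: algebra_simps)
  have X: "X p = P p + u p *\<^sub>R e" "u p = X p $ 3" if "p \<in> B" for p
    using assms(6) that by (auto simp: B_def P_def e_def vec_eq_iff forall_3 axis_def)
  have g4: "Ck_on 4 g B" using assms(2) by (simp add: Riemannian_metric_on_def B_def)
  have XC: "\<exists>L. L-lipschitz_on B X" "\<And>p. p \<in> B \<Longrightarrow> X differentiable (at p)"
    "\<And>i. \<exists>L. L-lipschitz_on B (pderiv_at i X)"
    using assms(4) by (auto simp: Ck1_embedding_on_def B_def)
  have D: "(u has_derivative Du p) (at p)" if p: "p \<in> B" for p
  proof -
    have "((\<lambda>q. X q $ 3) has_derivative (\<lambda>v. frechet_derivative X (at p) v $ 3)) (at p)"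
      using XC(2)[OF p] by (intro bounded_linear.has_derivative[OF bounded_linear_vec_nth])
        (simp add: frechet_derivative_works)
    then have "(u has_derivative (\<lambda>v. frechet_derivative X (at p) v $ 3)) (at p)"
      by (rule has_derivative_transform_within_open[of _ _ _ _ B]) (use p X(2) in \<open>auto simp: B_def\<close>)
    then have "u differentiable (at p)" unfolding differentiable_def by blast
    then show ?thesis unfolding Du_def by (simp add: frechet_derivative_works)
  qed
  have DX: "frechet_derivative X (at p) v = P v + Du p v *\<^sub>R e" if p: "p \<in> B" for p v
  proof -
    have "((\<lambda>q. P q + u q *\<^sub>R e) has_derivative (\<lambda>v. P v + Du p v *\<^sub>R e)) (at p)"
      by (intro has_derivative_add bounded_linear_imp_has_derivative P has_derivative_scaleR_left D p)
    then have "(X has_derivative (\<lambda>v. P v + Du p v *\<^sub>R e)) (at p)"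
      by (rule has_derivative_transform_within_open[of _ _ _ _ B]) (use p X(1) in \<open>auto simp: B_def\<close>)
    from frechet_derivative_at[OF this] show ?thesis by metis
  qed
  have square: "(Du p v)\<^sup>2 = v \<bullet> (g p *v v) - v \<bullet> v" if "p \<in> B" for p v
  proof -
    have "(P v + Du p v *\<^sub>R e) \<bullet> (P v + Du p v *\<^sub>R e) = v \<bullet> (g p *v v)"
      using assms(5) that unfolding isometric_on_def B_def[symmetric] DX[OF that, symmetric] by blast
    moreover have "(P v + Du p v *\<^sub>R e) \<bullet> (P v + Du p v *\<^sub>R e) = v \<bullet> v + (Du p v)\<^sup>2"
      by (simp add: P_def e_def inner_vec_def sum_2 sum_3 axis_def power2_eq_square)
    ultimately show ?thesis by simp
  qed
  have pX: "pderiv_at i X p = P (axis i 1) + Du p (axis i 1) *\<^sub>R e" if "p \<in> B" for i p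
    by (simp add: pderiv_at_def DX that)
  have e1: "e \<bullet> e = 1" by (simp add: e_def inner_axis_axis)
  have Pe: "P v \<bullet> e = 0" for v by (simp add: P_def e_def inner_axis_axis inner_add_left)
  have lipD: "\<exists>L. L-lipschitz_on B (\<lambda>p. Du p (axis i 1))" for i
  proof -
    obtain L where L: "L-lipschitz_on B (pderiv_at i X)" using XC(3) by blast
    have "L-lipschitz_on B (\<lambda>p. Du p (axis i 1))"
    proof (rule lipschitz_onI)
      fix p q assume pq: "p \<in> B" "q \<in> B"
      have "dist (Du p (axis i 1)) (Du q (axis i 1)) = dist (pderiv_at i X p) (pderiv_at i X q)"
        by (simp add: pX pq dist_norm norm_eq_sqrt_inner[of e] e1 flip: scaleR_left_diff_distrib)
      also have "\<dots> \<le> L * dist p q" by (rule lipschitz_onD[OF L pq])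
      finally show "dist (Du p (axis i 1)) (Du q (axis i 1)) \<le> L * dist p q" .
    qed (rule lipschitz_on_nonneg[OF L])
    then show ?thesis by blast
  qed
  have contD: "continuous_on B (\<lambda>p. Du p v)" for v
  proof -
    have "continuous_on B (\<lambda>p. \<Sum>i\<in>UNIV. v $ i *\<^sub>R Du p (axis i 1))"
      using lipD by (intro continuous_intros) (blast intro: lipschitz_on_continuous_on)
    moreover have "(\<Sum>i\<in>UNIV. v $ i *\<^sub>R Du p (axis i 1)) = Du p v" if "p \<in> B" for p
      using frechet_derivative_eq_sum[OF differentiableI[OF D[OF that]], of v]
      by (simp add: Du_def pderiv_at_def)
    ultimately show ?thesis by (simp cong: continuous_on_cong)
  qed
  \<comment> \<open>the expansions hold on a ball slightly larger than the one on which the conclusion is drawn\<close>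
  define \<rho> where "\<rho> = (r' + r) / 2"
  have \<rho>: "r' < \<rho>" "\<rho> < r" using r' by (auto simp: \<rho>_def)
  have inB: "p \<in> B" if "norm p < \<rho>" for p using that \<rho> by (simp add: B_def)
  have lin: "linear (Du p)" if "norm p < \<rho>" for p
    using D[OF inB[OF that]] by (rule has_derivative_linear)
  obtain C R where CR: "0 \<le> C" "0 < R"
    "\<And>x v. norm x < \<rho> \<Longrightarrow> norm v = 1 \<Longrightarrow> \<exists>d. \<forall>t. 0 \<le> t \<and> t \<le> R \<longrightarrow>
       \<bar>u (x + t *\<^sub>R v) - u x - t * Du x v - d * t\<^sup>2 / 2\<bar> \<le> C * t ^ 3"
    using uniform_expansion_along_lines[OF g4[unfolded B_def] assms(10) D[unfolded B_def]
        contD[unfolded B_def] square[unfolded B_def] \<rho>(2)] by metis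
  obtain q where "directional_taylor u Du q C R \<rho>"
    using directional_taylorI[OF CR(1,2) lin CR(3)] by metis
  then interpret directional_taylor u Du q C R \<rho> .
  have sub: "ball 0 r' \<subseteq> B" using r' by (auto simp: B_def)
  have D2: "(pderiv_at i X has_derivative (\<lambda>k. hess p (axis i 1) k *\<^sub>R e)) (at p)"
    if p: "p \<in> ball 0 r'" for i p
  proof -
    have p\<rho>: "norm p < \<rho>" using p \<rho> by simp
    have "((\<lambda>q. P (axis i 1) + Du q (axis i 1) *\<^sub>R e) has_derivative (\<lambda>k. 0 + hess p (axis i 1) k *\<^sub>R e)) (at p)"
      by (intro has_derivative_add has_derivative_const has_derivative_scaleR_left has_derivative_Du p\<rho>)
    then have "(pderiv_at i X has_derivative (\<lambda>k. 0 + hess p (axis i 1) k *\<^sub>R e)) (at p)"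
      by (rule has_derivative_transform_within_open[of _ _ _ _ B]) (use inB[OF p\<rho>] pX in \<open>auto simp: B_def\<close>)
    then show ?thesis by simp
  qed
  have pD2: "pderiv_at j (pderiv_at i X) p = hess p (axis i 1) (axis j 1) *\<^sub>R e"
    if "p \<in> ball 0 r'" for i j p
    using frechet_derivative_at[OF D2[OF that]] unfolding pderiv_at_def[of j] by metis
  have "\<exists>L. L-lipschitz_on (ball 0 r') (pderiv_at j (pderiv_at i X))" for i j
  proof -
    have "bounded ((\<lambda>p. Du p (axis i 1)) ` B)"
      using lipD[of i] by (auto simp: B_def intro: bounded_uniformly_continuous_image lipschitz_on_uniformly_continuous)
    then have "bounded ((\<lambda>p. Du p (axis i 1)) ` ball 0 \<rho>)"
      by (rule bounded_subset) (use inB in auto)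
    from hess_lipschitz[OF \<rho>(1) this] obtain L
      where L: "L-lipschitz_on (ball 0 r') (\<lambda>p. hess p (axis i 1) (axis j 1))" by blast
    have "L-lipschitz_on (ball 0 r') (pderiv_at j (pderiv_at i X))"
    proof (rule lipschitz_onI)
      fix p p' :: "real^2" assume pp: "p \<in> ball 0 r'" "p' \<in> ball 0 r'"
      have "dist (pderiv_at j (pderiv_at i X) p) (pderiv_at j (pderiv_at i X) p')
          = dist (hess p (axis i 1) (axis j 1)) (hess p' (axis i 1) (axis j 1))"
        by (simp only: pD2[OF pp(1)] pD2[OF pp(2)])
          (simp add: dist_norm norm_eq_sqrt_inner[of e] e1 flip: scaleR_left_diff_distrib)
      also have "\<dots> \<le> L * dist p p'" by (rule lipschitz_onD[OF L pp])
      finally show "dist (pderiv_at j (pderiv_at i X) p) (pderiv_at j (pderiv_at i X) p') \<le> L * dist p p'" .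
    qed (rule lipschitz_on_nonneg[OF L])
    then show ?thesis by blast
  qed
  moreover have "\<exists>L. L-lipschitz_on (ball 0 r') X" "\<exists>L. L-lipschitz_on (ball 0 r') (pderiv_at i X)" for i
    using XC(1,3) sub by (blast intro: lipschitz_on_subset)+
  moreover have "\<forall>p\<in>ball 0 r'. X differentiable (at p)" using XC(2) sub by blast
  moreover have "\<forall>p\<in>ball 0 r'. pderiv_at i X differentiable (at p)" for i
    using D2 unfolding differentiable_def by blast
  ultimately show "Ck1_on 2 X (ball 0 r')"
    by (simp add: numeral_2_eq_2)
qed

end
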